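(* Let $(\mathbf{u}_h,p_h,\mathbf{E}_h,\mathbf{B}_h,\mathbf{j}_h)\in \mathbf{X}_h$ satisfy, for all $(\mathbf{v}_h,q_h,\mathbf{F}_h,\mathbf{C}_h,\mathbf{k}_h)\in \mathbf{X}_h$, $$\mathrm{Re}^{-1}(\nabla \mathbf{u}_h,\nabla \mathbf{v}_h)+((\mathbf{u}_h\cdot\nabla)\mathbf{u}_h,\mathbf{v}_h)-S(\mathbf{j}_h\times \mathbf{B}_h,\mathbf{v}_h)-(p_h,\nabla\cdot \mathbf{v}_h)=\langle \mathbf{f},\mathbf{v}_h\rangle,$$ $$(\mathbf{j}_h,\mathbf{F}_h)-(\mathbf{B}_h,\nabla\times \mathbf{F}_h)=0,$$ $$(\nabla\times \mathbf{E}_h,\mathbf{C}_h)+(\nabla\cdot \mathbf{B}_h,\nabla\cdot \mathbf{C}_h)=0,$$ $$\mathrm{Re_m}^{-1}(\mathbf{j}_h,\mathbf{k}_h)-(\mathbf{E}_h+\mathbf{u}_h\times \mathbf{B}_h-\mathrm{R_H}\,\mathbf{j}_h\times \mathbf{B}_h,\mathbf{k}_h)=0,$$ $$-(\nabla\cdot \mathbf{u}_h,q_h)=0.$$ Then: 1. (magnetic Gauss's law) $\nabla\cdot \mathbf{B}_h=0$; 2. (stationary Faraday's law) $\nabla\times \mathbf{E}_h=\mathbf{0}$; 3. (energy estimates) $$\mathrm{Re}^{-1}\|\nabla \mathbf{u}_h\|^2+\mathrm{Re_m}^{-1}S\|\mathbf{j}_h\|^2=\langle \mathbf{f},\mathbf{u}_h\rangle,$$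 $$\tfrac12 \mathrm{Re}^{-1}\|\nabla \mathbf{u}_h\|^2+\mathrm{Re_m}^{-1}S\|\mathbf{j}_h\|^2\le \tfrac{\mathrm{Re}}{2}\|\mathbf{f}\|_{-1}^2 .$$
   Context: $\Omega\subset\mathbb{R}^3$ is a bounded, contractible Lipschitz polyhedron; $(\cdot,\cdot)$ and $\|\cdot\|$ are the $L^2(\Omega)$ inner product and norm; $\langle\cdot,\cdot\rangle$ is the duality pairing between $H^{-1}$ and $H^1_0$. $\mathrm{Re},\mathrm{Re_m},S>0$ and $\mathrm{R_H}\ge 0$ are constants and $\mathbf{f}\in[H^{-1}(\Omega)]^3$. The norm $\|\mathbf{f}\|_{-1}$ is the dual norm $\sup_{\mathbf{v}\in [H^1_0(\Omega)]^3\setminus\{0\}}\langle \mathbf{f},\mathbf{v}\rangle/\|\nabla \mathbf{v}\|$. $H_0(\mathrm{curl})$ and $H_0(\mathrm{div})$ denote the spaces of $H(\mathrm{curl},\Omega)$, $H(\mathrm{div},\Omega)$ fields with vanishing tangential, respectively normal, trace on $\partial\Omega$. $H_0^h(\mathrm{grad})\subset H^1_0(\Omega)$, $H_0^h(\mathrm{curl})\subset H_0(\mathrm{curl})$, $H_0^h(\mathrm{div})\subset H_0(\mathrm{div})$, $L^2_h$ are conforming (finite-dimensional, piecewise polynomial) finite element spaces forming a finite element de Rham sequence $$0\to H_0^h(\mathrm{grad})\xrightarrow{\mathrm{grad}}H_0^h(\mathrm{curl})\xrightarrow{\mathrm{curl}}H_0^h(\mathrm{div})\xrightarrow{\mathrm{div}}L^2_h\to0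 ;$$ in particular $\nabla\times H_0^h(\mathrm{curl})\subset H_0^h(\mathrm{div})$. $\mathbf{V}_h\subset [H_0^1(\Omega)]^3$ and $Q_h\subset L^2_0(\Omega)$ (mean-zero $L^2$ functions) are finite element spaces for velocity and pressure forming an inf-sup stable pair which enforces incompressibility exactly: if $\mathbf{v}_h\in \mathbf{V}_h$ and $(\nabla\cdot\mathbf{v}_h,q_h)=0$ for all $q_h\in Q_h$, then $\nabla\cdot\mathbf{v}_h=0$. Finally $\mathbf{X}_h:=\mathbf{V}_h\times Q_h\times H_0^h(\mathrm{curl})\times H_0^h(\mathrm{div})\times H_0^h(\mathrm{curl})$. *)

theory Defs
  imports "HOL-Analysis.Analysis"
begin

type_synonym scalar_field = "real ^ 3 \<Rightarrow> real"
type_synonym vector_field = "real ^ 3 \<Rightarrow> real ^ 3"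
type_synonym matrix_field = "real ^ 3 \<Rightarrow> real ^ 3 ^ 3"

text \<open>
  Fields on a domain are total functions on the ambient space. Only their values almost everywhere
  on the domain matter: all spaces below are closed under changing a function off the domain or on
  a null set, so each equivalence class is represented by all of its members.
\<close>


section \<open>Lipschitz polyhedra\<close>

definition lipschitz_domain :: "(real ^ 3) set \<Rightarrow> bool" where
  "lipschitz_domain \<Omega> \<longleftrightarrow> open \<Omega> \<and> connected \<Omega> \<and> \<Omega> \<noteq> {} \<and>
     (\<forall>x\<in>frontier \<Omega>. \<exists>r>0. \<exists>e L g. norm e = 1 \<and> L-lipschitz_on {y. y \<bullet> e = 0} (g :: scalar_field) \<and>
        (\<forall>y\<in>ball x r. y \<in> \<Omega> \<longleftrightarrow> y \<bullet> e < g (y - (y \<bullet> e) *\<^sub>R e)))"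

text \<open>Not necessarily convex; in the library a polytope is the convex hull of a finite set.\<close>

definition lipschitz_polyhedron :: "(real ^ 3) set \<Rightarrow> bool" where
  "lipschitz_polyhedron \<Omega> \<longleftrightarrow> lipschitz_domain \<Omega> \<and>
     (\<exists>\<P>. finite \<P> \<and> (\<forall>P\<in>\<P>. polytope P) \<and> closure \<Omega> = \<Union>\<P>)"


section \<open>Square-integrable fields\<close>

definition L2 :: "(real ^ 3) set \<Rightarrow> (real ^ 3 \<Rightarrow> 'b::euclidean_space) set" where
  "L2 \<Omega> = {f. f \<in> borel_measurable (lebesgue_on \<Omega>) \<and>
              integrable (lebesgue_on \<Omega>) (\<lambda>x. (norm (f x))\<^sup>2)}"

text \<open>On matrix fields the inner product of the library is the Frobenius product.\<close>

definition l2_inner ::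
  "(real ^ 3) set \<Rightarrow> (real ^ 3 \<Rightarrow> 'b::euclidean_space) \<Rightarrow> (real ^ 3 \<Rightarrow> 'b) \<Rightarrow> real" where
  "l2_inner \<Omega> f g = integral\<^sup>L (lebesgue_on \<Omega>) (\<lambda>x. f x \<bullet> g x)"

definition l2_norm :: "(real ^ 3) set \<Rightarrow> (real ^ 3 \<Rightarrow> 'b::euclidean_space) \<Rightarrow> real" where
  "l2_norm \<Omega> f = sqrt (l2_inner \<Omega> f f)"

definition L2_0 :: "(real ^ 3) set \<Rightarrow> scalar_field set" where
  "L2_0 \<Omega> = {q \<in> L2 \<Omega>. integral\<^sup>L (lebesgue_on \<Omega>) q = 0}"


section \<open>Test functions\<close>

definition partial :: "3 \<Rightarrow> scalar_field \<Rightarrow> scalar_field" where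
  "partial i \<phi> x = frechet_derivative \<phi> (at x) (axis i 1)"

primrec C_k :: "nat \<Rightarrow> scalar_field \<Rightarrow> bool" where
  "C_k 0 \<phi> \<longleftrightarrow> continuous_on UNIV \<phi>"
| "C_k (Suc k) \<phi> \<longleftrightarrow> \<phi> differentiable_on UNIV \<and> (\<forall>i. C_k k (partial i \<phi>))"

definition test_functions :: "(real ^ 3) set \<Rightarrow> scalar_field set" where
  "test_functions \<Omega> =
     {\<phi>. (\<forall>k. C_k k \<phi>) \<and> (\<exists>K. compact K \<and> K \<subseteq> \<Omega> \<and> (\<forall>x. x \<notin> K \<longrightarrow> \<phi> x = 0))}"

definition test_fields :: "(real ^ 3) set \<Rightarrow> vector_field set" where
  "test_fields \<Omega> = {\<psi>. \<forall>i. (\<lambda>x. \<psi> x $ i) \<in> test_functions \<Omega>}"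

definition classical_grad :: "scalar_field \<Rightarrow> vector_field" where
  "classical_grad \<phi> x = (\<chi> i. partial i \<phi> x)"

definition classical_curl :: "vector_field \<Rightarrow> vector_field" where
  "classical_curl \<psi> x = vector
     [partial 2 (\<lambda>y. \<psi> y $ 3) x - partial 3 (\<lambda>y. \<psi> y $ 2) x,
      partial 3 (\<lambda>y. \<psi> y $ 1) x - partial 1 (\<lambda>y. \<psi> y $ 3) x,
      partial 1 (\<lambda>y. \<psi> y $ 2) x - partial 2 (\<lambda>y. \<psi> y $ 1) x]"


section \<open>Weak differential operators\<close>

definition is_weak_grad :: "(real ^ 3) set \<Rightarrow> scalar_field \<Rightarrow> vector_field \<Rightarrow> bool" where
  "is_weak_grad \<Omega> u g \<longleftrightarrow> g \<in> L2 \<Omega> \<and>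
     (\<forall>\<phi>\<in>test_functions \<Omega>. \<forall>i. l2_inner \<Omega> u (partial i \<phi>) = - l2_inner \<Omega> (\<lambda>x. g x $ i) \<phi>)"

definition is_weak_curl :: "(real ^ 3) set \<Rightarrow> vector_field \<Rightarrow> vector_field \<Rightarrow> bool" where
  "is_weak_curl \<Omega> u w \<longleftrightarrow> w \<in> L2 \<Omega> \<and>
     (\<forall>\<psi>\<in>test_fields \<Omega>. l2_inner \<Omega> u (classical_curl \<psi>) = l2_inner \<Omega> w \<psi>)"

definition is_weak_div :: "(real ^ 3) set \<Rightarrow> vector_field \<Rightarrow> scalar_field \<Rightarrow> bool" where
  "is_weak_div \<Omega> u d \<longleftrightarrow> d \<in> L2 \<Omega> \<and>
     (\<forall>\<phi>\<in>test_functions \<Omega>. l2_inner \<Omega> u (classical_grad \<phi>) = - l2_inner \<Omega> d \<phi>)"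

text \<open>
  A weak derivative is unique up to null sets; the operators below pick some representative and are
  only meaningful on the spaces \<open>H1\<close>, \<open>Hcurl\<close> and \<open>Hdiv\<close>, respectively.
\<close>

definition weak_grad :: "(real ^ 3) set \<Rightarrow> scalar_field \<Rightarrow> vector_field" where
  "weak_grad \<Omega> u = (SOME g. is_weak_grad \<Omega> u g)"

definition weak_curl :: "(real ^ 3) set \<Rightarrow> vector_field \<Rightarrow> vector_field" where
  "weak_curl \<Omega> u = (SOME w. is_weak_curl \<Omega> u w)"

definition weak_div :: "(real ^ 3) set \<Rightarrow> vector_field \<Rightarrow> scalar_field" where
  "weak_div \<Omega> u = (SOME d. is_weak_div \<Omega> u d)"

text \<open>Row \<open>i\<close> is the gradient of the \<open>i\<close>-th component, so \<open>weak_jac \<Omega> u x *v a\<close> is \<open>(a \<cdot> \<nabla>) u\<close> at \<open>x\<close>.\<close>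

definition weak_jac :: "(real ^ 3) set \<Rightarrow> vector_field \<Rightarrow> matrix_field" where
  "weak_jac \<Omega> u x = (\<chi> i. weak_grad \<Omega> (\<lambda>y. u y $ i) x)"

definition convect :: "(real ^ 3) set \<Rightarrow> vector_field \<Rightarrow> vector_field \<Rightarrow> vector_field" where
  "convect \<Omega> a u x = weak_jac \<Omega> u x *v a x"


section \<open>Sobolev spaces\<close>

definition H1 :: "(real ^ 3) set \<Rightarrow> scalar_field set" where
  "H1 \<Omega> = {u \<in> L2 \<Omega>. \<exists>g. is_weak_grad \<Omega> u g}"

definition Hcurl :: "(real ^ 3) set \<Rightarrow> vector_field set" where
  "Hcurl \<Omega> = {u \<in> L2 \<Omega>. \<exists>w. is_weak_curl \<Omega> u w}"

definition Hdiv :: "(real ^ 3) set \<Rightarrow> vector_field set" where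
  "Hdiv \<Omega> = {u \<in> L2 \<Omega>. \<exists>d. is_weak_div \<Omega> u d}"

text \<open>The closure of the test functions in the \<open>H1\<close> norm.\<close>

definition H1_0 :: "(real ^ 3) set \<Rightarrow> scalar_field set" where
  "H1_0 \<Omega> = {u \<in> H1 \<Omega>. \<forall>\<epsilon>>0. \<exists>\<phi>\<in>test_functions \<Omega>.
     sqrt ((l2_norm \<Omega> (\<lambda>x. u x - \<phi> x))\<^sup>2 +
           (l2_norm \<Omega> (\<lambda>x. weak_grad \<Omega> u x - classical_grad \<phi> x))\<^sup>2) < \<epsilon>}"

definition H1v :: "(real ^ 3) set \<Rightarrow> vector_field set" where
  "H1v \<Omega> = {u. \<forall>i. (\<lambda>x. u x $ i) \<in> H1 \<Omega>}"

definition H1v_0 :: "(real ^ 3) set \<Rightarrow> vector_field set" where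
  "H1v_0 \<Omega> = {u. \<forall>i. (\<lambda>x. u x $ i) \<in> H1_0 \<Omega>}"

definition H1v_norm :: "(real ^ 3) set \<Rightarrow> vector_field \<Rightarrow> real" where
  "H1v_norm \<Omega> u = sqrt ((l2_norm \<Omega> u)\<^sup>2 + (l2_norm \<Omega> (weak_jac \<Omega> u))\<^sup>2)"

text \<open>
  The tangential trace of \<open>u\<close> in \<open>Hcurl\<close> and the normal trace of \<open>u\<close> in \<open>Hdiv\<close> are the functionals on
  boundary values of \<open>H1\<close> fields given by the left-hand sides of these Green formulas; for smooth
  \<open>u\<close> they are the integrals of \<open>(n \<times> u) \<cdot> \<phi>\<close> and \<open>(u \<cdot> n) \<phi>\<close> over the boundary.
\<close>

definition Hcurl_0 :: "(real ^ 3) set \<Rightarrow> vector_field set" where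
  "Hcurl_0 \<Omega> = {u \<in> Hcurl \<Omega>. \<forall>\<phi>\<in>H1v \<Omega>.
     l2_inner \<Omega> (weak_curl \<Omega> u) \<phi> - l2_inner \<Omega> u (weak_curl \<Omega> \<phi>) = 0}"

definition Hdiv_0 :: "(real ^ 3) set \<Rightarrow> vector_field set" where
  "Hdiv_0 \<Omega> = {u \<in> Hdiv \<Omega>. \<forall>\<phi>\<in>H1 \<Omega>.
     l2_inner \<Omega> (weak_div \<Omega> u) \<phi> + l2_inner \<Omega> u (weak_grad \<Omega> \<phi>) = 0}"

text \<open>The dual of \<open>H1v_0\<close>; only the values of a functional on \<open>H1v_0\<close> matter.\<close>

definition Hm1v :: "(real ^ 3) set \<Rightarrow> (vector_field \<Rightarrow> real) set" where
  "Hm1v \<Omega> = {f.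
     (\<forall>v\<in>H1v_0 \<Omega>. \<forall>w\<in>H1v_0 \<Omega>. f (\<lambda>x. v x + w x) = f v + f w) \<and>
     (\<forall>v\<in>H1v_0 \<Omega>. \<forall>c. f (\<lambda>x. c *\<^sub>R v x) = c * f v) \<and>
     (\<exists>C. \<forall>v\<in>H1v_0 \<Omega>. \<bar>f v\<bar> \<le> C * H1v_norm \<Omega> v)}"

definition Hm1v_norm :: "(real ^ 3) set \<Rightarrow> (vector_field \<Rightarrow> real) \<Rightarrow> real" where
  "Hm1v_norm \<Omega> f =
     (SUP v\<in>{v \<in> H1v_0 \<Omega>. l2_norm \<Omega> v \<noteq> 0}. f v / l2_norm \<Omega> (weak_jac \<Omega> v))"


section \<open>Finite element spaces\<close>

text \<open>
  Cells are arbitrary convex polytopes, so tetrahedral and hexahedral meshes and their refinements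
  are covered.
\<close>

definition mesh :: "(real ^ 3) set \<Rightarrow> (real ^ 3) set set \<Rightarrow> bool" where
  "mesh \<Omega> \<T> \<longleftrightarrow> finite \<T> \<and> (\<forall>T\<in>\<T>. polytope T \<and> interior T \<noteq> {}) \<and>
     (\<forall>T\<in>\<T>. \<forall>T'\<in>\<T>. T \<noteq> T' \<longrightarrow> interior T \<inter> interior T' = {}) \<and> closure \<Omega> = \<Union>\<T>"

definition piecewise_polynomial ::
  "(real ^ 3) set \<Rightarrow> (real ^ 3) set set \<Rightarrow> (real ^ 3 \<Rightarrow> 'b::euclidean_space) \<Rightarrow> bool" where
  "piecewise_polynomial \<Omega> \<T> v \<longleftrightarrow>
     (\<forall>T\<in>\<T>. \<exists>p. polynomial_function p \<and> (AE x in lebesgue_on \<Omega>. x \<in> T \<longrightarrow> v x = p x))"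

text \<open>
  A finite-dimensional subspace of \<open>L2\<close> (as a space of classes modulo null sets) that consists of
  piecewise polynomial fields.
\<close>

definition fe_space ::
  "(real ^ 3) set \<Rightarrow> (real ^ 3) set set \<Rightarrow> (real ^ 3 \<Rightarrow> 'b::euclidean_space) set \<Rightarrow> bool" where
  "fe_space \<Omega> \<T> V \<longleftrightarrow> V \<subseteq> L2 \<Omega> \<and>
     (\<lambda>x. 0) \<in> V \<and> (\<forall>v\<in>V. \<forall>w\<in>V. (\<lambda>x. v x + w x) \<in> V) \<and> (\<forall>v\<in>V. \<forall>c. (\<lambda>x. c *\<^sub>R v x) \<in> V) \<and>
     (\<forall>v\<in>V. \<forall>w. (AE x in lebesgue_on \<Omega>. w x = v x) \<longrightarrow> w \<in> V) \<and>
     (\<exists>B. finite B \<and> B \<subseteq> V \<and>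
        (\<forall>v\<in>V. \<exists>c. AE x in lebesgue_on \<Omega>. v x = (\<Sum>b\<in>B. c b *\<^sub>R b x))) \<and>
     (\<forall>v\<in>V. piecewise_polynomial \<Omega> \<T> v)"

text \<open>Being closed under null-set changes, the spaces contain every representative of a derivative.\<close>

definition fe_de_rham ::
  "(real ^ 3) set \<Rightarrow> (real ^ 3) set set \<Rightarrow> scalar_field set \<Rightarrow> vector_field set \<Rightarrow> vector_field set
     \<Rightarrow> scalar_field set \<Rightarrow> bool" where
  "fe_de_rham \<Omega> \<T> Gh Ch Dh Lh \<longleftrightarrow>
     fe_space \<Omega> \<T> Gh \<and> Gh \<subseteq> H1_0 \<Omega> \<and>
     fe_space \<Omega> \<T> Ch \<and> Ch \<subseteq> Hcurl_0 \<Omega> \<and>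
     fe_space \<Omega> \<T> Dh \<and> Dh \<subseteq> Hdiv_0 \<Omega> \<and>
     fe_space \<Omega> \<T> Lh \<and>
     weak_grad \<Omega> ` Gh \<subseteq> Ch \<and> weak_curl \<Omega> ` Ch \<subseteq> Dh \<and> weak_div \<Omega> ` Dh \<subseteq> Lh"

text \<open>Extended reals make the supremum the true one also when it ranges over the empty set.\<close>

definition inf_sup_stable ::
  "(real ^ 3) set \<Rightarrow> vector_field set \<Rightarrow> scalar_field set \<Rightarrow> bool" where
  "inf_sup_stable \<Omega> V Q \<longleftrightarrow> (\<exists>\<beta>>0. \<forall>q\<in>Q. l2_norm \<Omega> q \<noteq> 0 \<longrightarrow>
     ereal (\<beta> * l2_norm \<Omega> q) \<le>
       (SUP v\<in>{v \<in> V. l2_norm \<Omega> v \<noteq> 0}.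
          ereal (l2_inner \<Omega> (weak_div \<Omega> v) q / l2_norm \<Omega> (weak_jac \<Omega> v))))"

definition enforces_incompressibility ::
  "(real ^ 3) set \<Rightarrow> vector_field set \<Rightarrow> scalar_field set \<Rightarrow> bool" where
  "enforces_incompressibility \<Omega> V Q \<longleftrightarrow>
     (\<forall>v\<in>V. (\<forall>q\<in>Q. l2_inner \<Omega> (weak_div \<Omega> v) q = 0) \<longrightarrow>
        (AE x in lebesgue_on \<Omega>. weak_div \<Omega> v x = 0))"

end

theory Submission
  imports Defs "HOL-Computational_Algebra.Polynomial"
begin

text \<open>
  The structure-preserving complex allows \<open>curl E\<close> as a test function in the third equation. Its
  weak divergence vanishes (second derivatives of test functions commute, and a square-integrable
  function orthogonal to all test functions is zero), so \<open>curl E = 0\<close>; testing with \<open>B\<close> then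
  gives \<open>div B = 0\<close>.

  For the energy identity the equations are tested with the solution itself. The pressure term
  vanishes by the mass equation. The convection term vanishes because \<open>u\<close> is divergence-free and,
  being piecewise polynomial, bounded; this makes the term continuous in \<open>H1\<close>, so that it suffices
  to consider test functions. Ohm's and Ampere's laws turn \<open>\<parallel>j\<parallel>\<^sup>2 / Rem\<close> into \<open>- (j \<times> B, u)\<close>; the
  Hall term does not contribute as \<open>j \<times> B\<close> is orthogonal to \<open>j\<close>. The estimate follows by Young's
  inequality, where Poincare's inequality bounds the set whose supremum is \<open>Hm1v_norm\<close>.
\<close>

section \<open>The space \<open>L2\<close>\<close>

lemma L2_D:
  assumes "f \<in> L2 \<Omega>"
  shows "f \<in> borel_measurable (lebesgue_on \<Omega>)" "integrable (lebesgue_on \<Omega>) (\<lambda>x. (norm (f x))\<^sup>2)"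
  using assms by (auto simp: L2_def)

lemma L2_inner_integrable:
  fixes f g :: "real ^ 3 \<Rightarrow> 'b::euclidean_space"
  assumes f: "f \<in> L2 \<Omega>" and g: "g \<in> L2 \<Omega>"
  shows "integrable (lebesgue_on \<Omega>) (\<lambda>x. f x \<bullet> g x)"
proof (rule Bochner_Integration.integrable_bound)
  show "integrable (lebesgue_on \<Omega>) (\<lambda>x. (norm (f x))\<^sup>2 + (norm (g x))\<^sup>2)"
    using L2_D[OF f] L2_D[OF g] by auto
  show "(\<lambda>x. f x \<bullet> g x) \<in> borel_measurable (lebesgue_on \<Omega>)"
    using L2_D[OF f] L2_D[OF g] by (intro borel_measurable_inner)
  show "AE x in lebesgue_on \<Omega>. norm (f x \<bullet> g x) \<le> norm ((norm (f x))\<^sup>2 + (norm (g x))\<^sup>2)"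
  proof (rule AE_I2)
    fix x
    have "\<bar>f x \<bullet> g x\<bar> \<le> norm (f x) * norm (g x)" by (rule Cauchy_Schwarz_ineq2)
    moreover have "2 * (norm (f x) * norm (g x)) \<le> (norm (f x))\<^sup>2 + (norm (g x))\<^sup>2"
      using sum_squares_bound[of "norm (f x)" "norm (g x)"] by simp
    ultimately show "norm (f x \<bullet> g x) \<le> norm ((norm (f x))\<^sup>2 + (norm (g x))\<^sup>2)"
      by simp
  qed
qed

lemma L2_add:
  fixes f g :: "real ^ 3 \<Rightarrow> 'b::euclidean_space"
  assumes f: "f \<in> L2 \<Omega>" and g: "g \<in> L2 \<Omega>"
  shows "(\<lambda>x. f x + g x) \<in> L2 \<Omega>"
proof -
  have "integrable (lebesgue_on \<Omega>) (\<lambda>x. (norm (f x))\<^sup>2 + (norm (g x))\<^sup>2 + 2 * (f x \<bullet> g x))"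
    using L2_D[OF f] L2_D[OF g] L2_inner_integrable[OF f g] by auto
  moreover have "(norm (f x + g x))\<^sup>2 = (norm (f x))\<^sup>2 + (norm (g x))\<^sup>2 + 2 * (f x \<bullet> g x)" for x
    by (simp add: power2_norm_eq_inner inner_add inner_commute)
  ultimately show ?thesis
    using L2_D[OF f] L2_D[OF g] by (auto simp: L2_def)
qed

lemma L2_scaleR:
  fixes f :: "real ^ 3 \<Rightarrow> 'b::euclidean_space"
  assumes "f \<in> L2 \<Omega>"
  shows "(\<lambda>x. c *\<^sub>R f x) \<in> L2 \<Omega>"
  using L2_D[OF assms] by (auto simp: L2_def power_mult_distrib)

lemma L2_diff:
  fixes f g :: "real ^ 3 \<Rightarrow> 'b::euclidean_space"
  assumes "f \<in> L2 \<Omega>" "g \<in> L2 \<Omega>"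
  shows "(\<lambda>x. f x - g x) \<in> L2 \<Omega>"
  using L2_add[OF assms(1) L2_scaleR[OF assms(2), of "-1"]] by simp

text \<open>Membership by domination. \<open>f\<close> and \<open>g\<close> may take values in
  different spaces, so that the lemma serves components, scalar multiples, inner products and cross
  products alike.\<close>

lemma L2_bound:
  fixes f :: "real ^ 3 \<Rightarrow> 'b::euclidean_space" and g :: "real ^ 3 \<Rightarrow> 'c::euclidean_space"
  assumes f: "f \<in> L2 \<Omega>" and g: "g \<in> borel_measurable (lebesgue_on \<Omega>)"
    and le: "AE x in lebesgue_on \<Omega>. norm (g x) \<le> norm (f x)"
  shows "g \<in> L2 \<Omega>"
proof -
  have "integrable (lebesgue_on \<Omega>) (\<lambda>x. (norm (g x))\<^sup>2)"
  proof (rule Bochner_Integration.integrable_bound[OF L2_D(2)[OF f]])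
    show "(\<lambda>x. (norm (g x))\<^sup>2) \<in> borel_measurable (lebesgue_on \<Omega>)"
      by (intro borel_measurable_power measurable_compose[OF g borel_measurable_norm])
    show "AE x in lebesgue_on \<Omega>. norm ((norm (g x))\<^sup>2) \<le> norm ((norm (f x))\<^sup>2)"
      using le by eventually_elim (simp add: power_mono)
  qed
  then show ?thesis using g by (auto simp: L2_def)
qed

lemma L2_bounded_scaleR:
  fixes f :: "real ^ 3 \<Rightarrow> 'b::euclidean_space"
  assumes f: "f \<in> L2 \<Omega>" and a: "a \<in> borel_measurable (lebesgue_on \<Omega>)"
    and bound: "AE x in lebesgue_on \<Omega>. \<bar>a x\<bar> \<le> M"
  shows "(\<lambda>x. a x *\<^sub>R f x) \<in> L2 \<Omega>"
proof (rule L2_bound[OF L2_scaleR[OF f, of M]])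
  show "(\<lambda>x. a x *\<^sub>R f x) \<in> borel_measurable (lebesgue_on \<Omega>)"
    using L2_D[OF f] a by auto
  show "AE x in lebesgue_on \<Omega>. norm (a x *\<^sub>R f x) \<le> norm (M *\<^sub>R f x)"
    using bound by eventually_elim (auto intro: mult_right_mono)
qed

lemma L2_component:
  fixes f :: "real ^ 3 \<Rightarrow> 'a::euclidean_space ^ 'n::finite"
  assumes "f \<in> L2 \<Omega>"
  shows "(\<lambda>x. f x $ i) \<in> L2 \<Omega>"
proof (rule L2_bound[OF assms])
  show "(\<lambda>x. f x $ i) \<in> borel_measurable (lebesgue_on \<Omega>)"
    by (rule measurable_compose[OF L2_D(1)[OF assms] borel_measurable_continuous_onI])
       (intro continuous_intros)
qed (simp add: Finite_Cartesian_Product.norm_nth_le)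

lemma borel_measurable_vec_lambda:
  fixes f :: "'i::finite \<Rightarrow> 'a \<Rightarrow> 'b::euclidean_space"
  assumes "\<And>i. f i \<in> borel_measurable M"
  shows "(\<lambda>x. \<chi> i. f i x) \<in> borel_measurable M"
proof (subst borel_measurable_euclidean_space, rule ballI)
  fix b :: "'b ^ 'i" assume "b \<in> Basis"
  have "(\<chi> i. f i x) \<bullet> b = (\<Sum>i\<in>UNIV. f i x \<bullet> (b $ i))" for x
    by (simp add: inner_vec_def)
  then show "(\<lambda>x. (\<chi> i. f i x) \<bullet> b) \<in> borel_measurable M"
    using assms by simp
qed

lemma norm_vec_sq:
  fixes v :: "'a::euclidean_space ^ 'n::finite"
  shows "(norm v)\<^sup>2 = (\<Sum>i\<in>UNIV. (norm (v $ i))\<^sup>2)"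
  by (simp add: power2_norm_eq_inner inner_vec_def)

lemma L2_vec_lambda:
  fixes f :: "'n::finite \<Rightarrow> real ^ 3 \<Rightarrow> 'a::euclidean_space"
  assumes "\<And>i. f i \<in> L2 \<Omega>"
  shows "(\<lambda>x. \<chi> i. f i x) \<in> L2 \<Omega>"
  using assms by (auto simp: L2_def norm_vec_sq intro!: borel_measurable_vec_lambda)

section \<open>Algebra and inequalities of the L2 inner product\<close>

lemma l2_inner_add_left:
  assumes "f \<in> L2 \<Omega>" "g \<in> L2 \<Omega>" "h \<in> L2 \<Omega>"
  shows "l2_inner \<Omega> (\<lambda>x. f x + g x) h = l2_inner \<Omega> f h + l2_inner \<Omega> g h"
  using assms by (simp add: l2_inner_def inner_add_left L2_inner_integrable)

lemma l2_inner_diff_left: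
  assumes "f \<in> L2 \<Omega>" "g \<in> L2 \<Omega>" "h \<in> L2 \<Omega>"
  shows "l2_inner \<Omega> (\<lambda>x. f x - g x) h = l2_inner \<Omega> f h - l2_inner \<Omega> g h"
  using assms by (simp add: l2_inner_def inner_diff_left L2_inner_integrable)

lemma l2_inner_commute: "l2_inner \<Omega> f g = l2_inner \<Omega> g f"
  by (simp add: l2_inner_def inner_commute)

lemma l2_inner_self_nonneg: "l2_inner \<Omega> f f \<ge> 0"
  by (simp add: l2_inner_def)

lemma l2_norm_sq: "(l2_norm \<Omega> f)\<^sup>2 = l2_inner \<Omega> f f"
  by (simp add: l2_norm_def l2_inner_self_nonneg)

lemma l2_norm_nonneg [simp]: "l2_norm \<Omega> f \<ge> 0"
  by (simp add: l2_norm_def l2_inner_self_nonneg)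

text \<open>Turns a tested equation \<open>(f, f) = 0\<close> into an almost-everywhere statement.
  Membership in \<open>L2\<close> matters, since a non-integrable function also has Bochner integral
  \<open>0\<close>.\<close>

lemma l2_inner_self_eq_0_iff:
  assumes "f \<in> L2 \<Omega>"
  shows "l2_inner \<Omega> f f = 0 \<longleftrightarrow> (AE x in lebesgue_on \<Omega>. f x = 0)"
  unfolding l2_inner_def
  by (subst integral_nonneg_eq_0_iff_AE) (use L2_inner_integrable[OF assms assms] in auto)

lemma l2_norm_eq_0_iff:
  assumes "f \<in> L2 \<Omega>"
  shows "l2_norm \<Omega> f = 0 \<longleftrightarrow> (AE x in lebesgue_on \<Omega>. f x = 0)"
  using l2_inner_self_eq_0_iff[OF assms] by (simp add: l2_norm_def)

lemma l2_inner_AE_zero_left: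
  assumes "AE x in lebesgue_on \<Omega>. f x = 0"
  shows "l2_inner \<Omega> f g = 0"
  unfolding l2_inner_def
  by (rule integral_eq_zero_AE) (use assms in \<open>auto elim: eventually_mono\<close>)

text \<open>Discriminant argument: \<open>a - 2 t b + t^2 c\<close> is the squared norm of
  \<open>f - t g\<close>, hence nonnegative, and \<open>t = b / c\<close> minimises it. If
  \<open>c = 0\<close>, then \<open>g\<close> vanishes almost everywhere and
  \<open>b = 0\<close>.\<close>

lemma l2_Cauchy_Schwarz:
  fixes f g :: "real ^ 3 \<Rightarrow> 'b::euclidean_space"
  assumes f: "f \<in> L2 \<Omega>" and g: "g \<in> L2 \<Omega>"
  shows "\<bar>l2_inner \<Omega> f g\<bar> \<le> l2_norm \<Omega> f * l2_norm \<Omega> g"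
proof -
  define a b c where "a = l2_inner \<Omega> f f" and "b = l2_inner \<Omega> f g" and "c = l2_inner \<Omega> g g"
  have quad: "0 \<le> a - 2 * t * b + t\<^sup>2 * c" for t
  proof -
    have "(\<lambda>x. (f x - t *\<^sub>R g x) \<bullet> (f x - t *\<^sub>R g x)) =
        (\<lambda>x. (f x \<bullet> f x - 2 * t * (f x \<bullet> g x)) + t\<^sup>2 * (g x \<bullet> g x))"
      by (auto simp: inner_diff inner_commute power2_eq_square algebra_simps)
    then have "l2_inner \<Omega> (\<lambda>x. f x - t *\<^sub>R g x) (\<lambda>x. f x - t *\<^sub>R g x) = a - 2 * t * b + t\<^sup>2 * c"
      unfolding a_def b_def c_def l2_inner_def
      using L2_inner_integrable[OF f g] L2_inner_integrable[OF f f] L2_inner_integrable[OF g g]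
      by simp
    then show ?thesis using l2_inner_self_nonneg by metis
  qed
  have "b\<^sup>2 \<le> a * c"
  proof (cases "c = 0")
    case True
    then have "b = 0"
      using l2_inner_self_eq_0_iff[OF g] l2_inner_AE_zero_left[of g \<Omega> f]
      by (simp add: b_def c_def l2_inner_commute)
    then show ?thesis using True by simp
  next
    case False
    then have "c > 0" using l2_inner_self_nonneg[of \<Omega> g] by (simp add: c_def less_le)
    with quad[of "b / c"] show ?thesis
      by (simp add: field_simps power2_eq_square)
  qed
  then have "\<bar>b\<bar> \<le> sqrt (a * c)"
    by (simp add: real_le_rsqrt)
  then show ?thesis
    by (simp add: a_def b_def c_def l2_norm_def real_sqrt_mult)
qed

lemma l2_norm_scaleR: "l2_norm \<Omega> (\<lambda>x. c *\<^sub>R f x) = \<bar>c\<bar> * l2_norm \<Omega> f"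
  by (simp add: l2_norm_def l2_inner_def real_sqrt_mult flip: power2_eq_square mult.assoc)

lemma l2_norm_triangle:
  fixes f g :: "real ^ 3 \<Rightarrow> 'b::euclidean_space"
  assumes f: "f \<in> L2 \<Omega>" and g: "g \<in> L2 \<Omega>"
  shows "l2_norm \<Omega> (\<lambda>x. f x + g x) \<le> l2_norm \<Omega> f + l2_norm \<Omega> g"
proof (rule power2_le_imp_le)
  have "(l2_norm \<Omega> (\<lambda>x. f x + g x))\<^sup>2 =
      (l2_norm \<Omega> f)\<^sup>2 + (l2_norm \<Omega> g)\<^sup>2 + 2 * l2_inner \<Omega> f g"
    using l2_inner_add_left[OF f g L2_add[OF f g]]
      l2_inner_add_left[OF f g f] l2_inner_add_left[OF f g g]
    by (simp add: l2_norm_sq l2_inner_commute)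
  also have "\<dots> \<le> (l2_norm \<Omega> f + l2_norm \<Omega> g)\<^sup>2"
    using l2_Cauchy_Schwarz[OF f g] by (simp add: power2_sum)
  finally show "(l2_norm \<Omega> (\<lambda>x. f x + g x))\<^sup>2 \<le> (l2_norm \<Omega> f + l2_norm \<Omega> g)\<^sup>2" .
qed simp

lemma l2_norm_minus_commute: "l2_norm \<Omega> (\<lambda>x. f x - g x) = l2_norm \<Omega> (\<lambda>x. g x - f x)"
  by (simp add: l2_norm_def l2_inner_def power2_norm_eq_inner[symmetric] norm_minus_commute)

lemma l2_norm_sq_components:
  fixes f :: "real ^ 3 \<Rightarrow> 'a::euclidean_space ^ 'n::finite"
  assumes "f \<in> L2 \<Omega>"
  shows "(l2_norm \<Omega> f)\<^sup>2 = (\<Sum>i\<in>UNIV. (l2_norm \<Omega> (\<lambda>x. f x $ i))\<^sup>2)"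
  using L2_inner_integrable[OF L2_component L2_component, OF assms assms]
  by (simp add: l2_norm_sq l2_inner_def inner_vec_def)

lemma l2_norm_mono:
  fixes f :: "real ^ 3 \<Rightarrow> 'a::euclidean_space" and g :: "real ^ 3 \<Rightarrow> 'b::euclidean_space"
  assumes f: "f \<in> L2 \<Omega>" and g: "g \<in> L2 \<Omega>"
    and le: "AE x in lebesgue_on \<Omega>. norm (f x) \<le> norm (g x)"
  shows "l2_norm \<Omega> f \<le> l2_norm \<Omega> g"
  unfolding l2_norm_def l2_inner_def real_sqrt_le_iff
  by (rule integral_mono_AE)
     (use L2_inner_integrable[OF f f] L2_inner_integrable[OF g g] le in
       \<open>auto simp: power2_norm_eq_inner[symmetric] elim!: eventually_mono intro: power_mono\<close>)

lemma L2_bounded: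
  fixes f :: "real ^ 3 \<Rightarrow> 'a::euclidean_space"
  assumes "\<Omega> \<in> lmeasurable" and f: "f \<in> borel_measurable (lebesgue_on \<Omega>)"
    and M: "AE x in lebesgue_on \<Omega>. norm (f x) \<le> M"
  shows "f \<in> L2 \<Omega>"
proof -
  interpret finite_measure "lebesgue_on \<Omega>"
    by (rule finite_measure_lebesgue_on) fact
  have "integrable (lebesgue_on \<Omega>) (\<lambda>x. (norm (f x))\<^sup>2)"
    by (rule integrable_const_bound[where B="M\<^sup>2"])
       (use f M in \<open>auto elim!: eventually_mono intro: power_mono\<close>)
  with f show ?thesis by (simp add: L2_def)
qed

section \<open>Smooth functions\<close>

lemma partial_eq:
  "(\<phi> has_derivative \<phi>') (at x) \<Longrightarrow> partial i \<phi> x = \<phi>' (axis i 1)"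
  unfolding partial_def using frechet_derivative_at by metis

lemma has_derivative_frechet:
  "\<phi> differentiable_on UNIV \<Longrightarrow> (\<phi> has_derivative frechet_derivative \<phi> (at x)) (at x)"
  by (simp add: differentiable_on_def frechet_derivative_works[symmetric])

text \<open>Restricting to a line turns \<open>partial\<close> into an ordinary derivative, to which
  the one-variable mean value theorem applies.\<close>

lemma has_derivative_along_axis:
  assumes "\<psi> differentiable_on UNIV"
  shows "((\<lambda>t. \<psi> (y + t *\<^sub>R axis k 1)) has_real_derivative partial k \<psi> (y + t *\<^sub>R axis k 1)) (at t)"
proof -
  note d = has_derivative_frechet[OF assms]
  have "((\<lambda>t. \<psi> (y + t *\<^sub>R axis k 1)) has_derivative
     (\<lambda>h. frechet_derivative \<psi> (at (y + t *\<^sub>R axis k 1)) (h *\<^sub>R axis k 1))) (at t)"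
    by (rule has_derivative_compose[OF _ d]) (auto intro!: derivative_eq_intros)
  moreover have "frechet_derivative \<psi> (at (y + t *\<^sub>R axis k 1)) (h *\<^sub>R axis k 1) =
      h * partial k \<psi> (y + t *\<^sub>R axis k 1)" for h
    using linear_cmul[OF has_derivative_linear[OF d]] by (simp add: partial_def)
  ultimately show ?thesis
    by (simp add: has_field_derivative_def mult_commute_abs)
qed

lemma partial_add:
  assumes "\<phi> differentiable_on UNIV" "\<psi> differentiable_on UNIV"
  shows "partial i (\<lambda>x. \<phi> x + \<psi> x) = (\<lambda>x. partial i \<phi> x + partial i \<psi> x)"
  using partial_eq[OF has_derivative_add[OF assms[THEN has_derivative_frechet]]]
  by (auto simp: fun_eq_iff partial_def)

lemma partial_mult:
  assumes "\<phi> differentiable_on UNIV" "\<psi> differentiable_on UNIV"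
  shows "partial i (\<lambda>x. \<phi> x * \<psi> x) = (\<lambda>x. \<phi> x * partial i \<psi> x + partial i \<phi> x * \<psi> x)"
proof
  fix x
  have "partial i (\<lambda>x. \<phi> x * \<psi> x) x =
      (\<lambda>h. \<phi> x * frechet_derivative \<psi> (at x) h + frechet_derivative \<phi> (at x) h * \<psi> x) (axis i 1)"
    by (rule partial_eq) (rule has_derivative_mult[OF assms[THEN has_derivative_frechet]])
  then show "partial i (\<lambda>x. \<phi> x * \<psi> x) x = \<phi> x * partial i \<psi> x + partial i \<phi> x * \<psi> x"
    by (simp add: partial_def)
qed

section \<open>Calculus of the classes \<open>C_k\<close>\<close>

lemma C_k_continuous: "C_k k \<phi> \<Longrightarrow> continuous_on UNIV \<phi>"
  by (cases k) (auto intro: differentiable_imp_continuous_on)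

text \<open>The recursion only speaks of the partial derivatives, so the inclusion of the classes
  needs an induction; its base case is that differentiable functions are continuous.\<close>

lemma C_k_SucD: "C_k (Suc k) \<phi> \<Longrightarrow> C_k k \<phi>"
proof (induction k arbitrary: \<phi>)
  case 0
  then show ?case by (auto intro: differentiable_imp_continuous_on)
next
  case (Suc k)
  from Suc.prems have "\<phi> differentiable_on UNIV" "\<And>i. C_k (Suc k) (partial i \<phi>)"
    by simp_all
  then show ?case using Suc.IH by simp
qed

lemma C_k_const: "C_k k (\<lambda>x. c)"
proof (induction k arbitrary: c)
  case (Suc k)
  have "partial i (\<lambda>x. c) = (\<lambda>x. 0)" for i
    by (rule ext) (simp add: partial_eq[OF has_derivative_const])
  with Suc show ?case by simp
qed simp

lemma C_k_add: "C_k k \<phi> \<Longrightarrow> C_k k \<psi> \<Longrightarrow> C_k k (\<lambda>x. \<phi> x + \<psi> x)"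
  by (induction k arbitrary: \<phi> \<psi>)
     (auto simp: partial_add intro: continuous_intros differentiable_on_add)

text \<open>The product rule pairs each derivative with an undifferentiated factor, so the factors
  are also needed one order lower, which \<open>C_k_SucD\<close> provides.\<close>

lemma C_k_mult: "C_k k \<phi> \<Longrightarrow> C_k k \<psi> \<Longrightarrow> C_k k (\<lambda>x. \<phi> x * \<psi> x)"
proof (induction k arbitrary: \<phi> \<psi>)
  case 0
  then show ?case by (auto intro: continuous_intros)
next
  case (Suc k)
  note d = C_k_SucD[OF Suc.prems(1)] C_k_SucD[OF Suc.prems(2)]
  have "\<phi> differentiable_on UNIV" "\<psi> differentiable_on UNIV"
    and "C_k k (partial i \<phi>)" "C_k k (partial i \<psi>)" for i
    using Suc.prems by simp_all
  then show ?case
    using d by (auto simp: partial_mult intro!: C_k_add Suc.IH differentiable_on_mult)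
qed

lemma C_k_prod: "(\<And>i. i \<in> I \<Longrightarrow> C_k k (\<phi> i)) \<Longrightarrow> C_k k (\<lambda>x. \<Prod>i\<in>I. \<phi> i x)"
  by (induction I rule: infinite_finite_induct) (auto intro: C_k_const C_k_mult)

text \<open>\<open>D\<close> lists all derivatives of a function of one variable. A partial
  derivative of the composition is a constant times the composition with the next member of
  \<open>D\<close>, so the induction on \<open>k\<close> runs over all \<open>n\<close> at
  once.\<close>

lemma C_k_compose_affine_coordinate:
  assumes D: "\<And>n t. (D n has_real_derivative D (Suc n) t) (at t)"
  shows "C_k k (\<lambda>x. D n (c * x $ i + d))"
proof (induction k arbitrary: n)
  case 0
  have "continuous_on UNIV (D n)"
    using D by (meson DERIV_isCont continuous_at_imp_continuous_on)
  then show ?case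
    by (auto intro!: continuous_on_compose2[of UNIV "D n"] continuous_intros)
next
  case (Suc k)
  have der: "((\<lambda>x. D n (c * x $ i + d)) has_derivative
      (\<lambda>h. D (Suc n) (c * x $ i + d) * (c * h $ i))) (at x)" for x :: "real ^ 3"
    by (rule has_derivative_compose[where g="D n", OF _ D[unfolded has_field_derivative_def]])
       (auto intro!: derivative_eq_intros bounded_linear.has_derivative[OF bounded_linear_vec_nth])
  have "partial j (\<lambda>x. D n (c * x $ i + d)) = (\<lambda>x. D (Suc n) (c * x $ i + d) * (c * axis j 1 $ i))" for j
    by (rule ext) (rule partial_eq[OF der])
  moreover have "(\<lambda>x. D n (c * x $ i + d)) differentiable_on UNIV"
    using der by (auto simp: differentiable_on_def differentiable_def)
  ultimately show ?case
    by (auto intro!: C_k_mult C_k_const Suc.IH)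
qed

lemma C_k_coordinate: "C_k k (\<lambda>x. x $ i)"
proof -
  \<comment> \<open>The successive derivatives of the identity: \<open>t\<close>, \<open>1\<close>,
    \<open>0\<close>, \<open>0\<close> and so on.\<close>
  define D :: "nat \<Rightarrow> real \<Rightarrow> real" where "D n t = (if n = 0 then t else if n = 1 then 1 else 0)" for n t
  have "(D n has_real_derivative D (Suc n) t) (at t)" for n t
    unfolding D_def by (cases "n = 0") auto
  then have "C_k k (\<lambda>x. D 0 (1 * x $ i + 0))" by (rule C_k_compose_affine_coordinate)
  then show ?thesis by (simp add: D_def)
qed

text \<open>The family is closed under differentiation, whence \<open>flat 1\<close>, that is \<open>exp (- 1 / t)\<close>
  extended by zero, is smooth.\<close>

definition flat :: "real poly \<Rightarrow> real \<Rightarrow> real" where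
  "flat p t = (if t > 0 then poly p (1 / t) * exp (- (1 / t)) else 0)"

lemma poly_times_exp_tendsto_0: "((\<lambda>x::real. poly p x * exp (- x)) \<longlongrightarrow> 0) at_top"
proof -
  have "((\<lambda>x. \<Sum>i\<le>degree p. coeff p i * (x ^ i / exp x)) \<longlongrightarrow> (\<Sum>i\<le>degree p. coeff p i * 0)) at_top"
    by (intro tendsto_intros tendsto_power_div_exp_0)
  then show ?thesis
    by (simp add: poly_altdef sum_distrib_right exp_minus divide_inverse mult.assoc)
qed

text \<open>For \<open>t > 0\<close> the product and chain rules give
  \<open>(p - p')(1 / t) exp (- 1 / t) / t^2\<close>, and \<open>[:0, 0, 1:]\<close> encodes the
  factor \<open>1 / t^2\<close>. At \<open>t = 0\<close> the one-sided limits of the difference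
  quotient are both \<open>0\<close>.\<close>

lemma flat_has_derivative:
  "(flat p has_real_derivative flat ([:0, 0, 1:] * (p - pderiv p)) t) (at t)"
proof -
  consider "t > 0" | "t < 0" | "t = 0" by linarith
  then show ?thesis
  proof cases
    case 1
    have "((\<lambda>t. poly p (1 / t) * exp (- (1 / t))) has_real_derivative
        flat ([:0, 0, 1:] * (p - pderiv p)) t) (at t)"
      using 1 by (auto intro!: derivative_eq_intros DERIV_chain2[OF poly_DERIV]
          simp: flat_def field_simps power2_eq_square)
    then show ?thesis
      by (rule has_field_derivative_transform_within_open[where S="{0<..}"])
         (use 1 in \<open>auto simp: flat_def\<close>)
  next
    case 2
    have "((\<lambda>t. 0) has_real_derivative flat ([:0, 0, 1:] * (p - pderiv p)) t) (at t)"
      using 2 by (simp add: flat_def)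
    then show ?thesis
      by (rule has_field_derivative_transform_within_open[where S="{..<0}"])
         (use 2 in \<open>auto simp: flat_def\<close>)
  next
    case 3
    have "((\<lambda>y. flat p y / y) \<longlongrightarrow> 0) (at_left 0)"
      by (rule tendsto_eventually) (auto simp: eventually_at_filter flat_def)
    \<comment> \<open>With \<open>x = 1 / y\<close> the quotient becomes
      \<open>x p(x) exp (- x)\<close>: the factor \<open>[:0, 1:]\<close> absorbs the division by
      \<open>y\<close>, and the exponential beats every polynomial.\<close>
    moreover have "((\<lambda>y. flat p y / y) \<longlongrightarrow> 0) (at_right 0)"
    proof (rule Lim_transform_eventually)
      show "((\<lambda>y. poly ([:0, 1:] * p) (inverse y) * exp (- inverse y)) \<longlongrightarrow> 0) (at_right (0::real))"
        using filterlim_compose[OF poly_times_exp_tendsto_0 filterlim_inverse_at_top_right] by blast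
      show "\<forall>\<^sub>F y in at_right 0. poly ([:0, 1:] * p) (inverse y) * exp (- inverse y) = flat p y / y"
        by (auto simp: eventually_at_filter flat_def divide_inverse)
    qed
    ultimately have "((\<lambda>y. flat p y / y) \<longlongrightarrow> 0) (at 0)"
      by (rule filterlim_split_at)
    then show ?thesis
      using 3 by (simp add: has_field_derivative_iff flat_def)
  qed
qed

lemma C_k_flat: "C_k k (\<lambda>x. flat 1 (c * x $ i + d))"
proof -
  \<comment> \<open>\<open>P n\<close> is the polynomial that belongs to the \<open>n\<close>-th
    derivative of \<open>flat 1\<close>.\<close>
  define P where "P n = ((\<lambda>p. [:0, 0, 1:] * (p - pderiv p)) ^^ n) (1 :: real poly)" for n
  have "(flat (P n) has_real_derivative flat (P (Suc n)) t) (at t)" for n t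
    unfolding P_def funpow.simps comp_def by (rule flat_has_derivative)
  from C_k_compose_affine_coordinate[of "\<lambda>n. flat (P n)", OF this, of k 0]
  show ?thesis by (simp add: P_def)
qed

section \<open>Symmetry of second derivatives\<close>

text \<open>Two applications of the mean value theorem: along axis \<open>i\<close> to the increment
  of \<open>\<phi>\<close> in direction \<open>j\<close>, then along axis \<open>j\<close> to
  \<open>partial i \<phi>\<close>. The left-hand side is symmetric in \<open>i\<close> and
  \<open>j\<close>, the right-hand side is not.\<close>

lemma second_difference_mean_value:
  assumes \<phi>: "C_k 2 \<phi>" and s: "s > 0"
  shows "\<exists>\<xi> \<eta>. 0 < \<xi> \<and> \<xi> < s \<and> 0 < \<eta> \<and> \<eta> < s \<and>
    \<phi> (x + s *\<^sub>R axis i 1 + s *\<^sub>R axis j 1) - \<phi> (x + s *\<^sub>R axis i 1) - \<phi> (x + s *\<^sub>R axis j 1) + \<phi> x =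
    s\<^sup>2 * partial j (partial i \<phi>) (x + \<xi> *\<^sub>R axis i 1 + \<eta> *\<^sub>R axis j 1)"
proof -
  have d1: "\<phi> differentiable_on UNIV" and d2: "partial i \<phi> differentiable_on UNIV"
    using \<phi> by (simp_all add: numeral_2_eq_2)
  define g where "g t = \<phi> ((x + s *\<^sub>R axis j 1) + t *\<^sub>R axis i 1) - \<phi> (x + t *\<^sub>R axis i 1)" for t
  have "\<exists>\<xi>>0. \<xi> < s \<and> g s - g 0 =
    (s - 0) * (partial i \<phi> ((x + s *\<^sub>R axis j 1) + \<xi> *\<^sub>R axis i 1) - partial i \<phi> (x + \<xi> *\<^sub>R axis i 1))"
    unfolding g_def by (rule MVT2) (use s d1 in \<open>auto intro!: DERIV_diff has_derivative_along_axis\<close>)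
  then obtain \<xi> where \<xi>: "0 < \<xi>" "\<xi> < s" "g s - g 0 =
    s * (partial i \<phi> ((x + s *\<^sub>R axis j 1) + \<xi> *\<^sub>R axis i 1) - partial i \<phi> (x + \<xi> *\<^sub>R axis i 1))"
    by auto
  have "\<exists>\<eta>>0. \<eta> < s \<and> partial i \<phi> ((x + \<xi> *\<^sub>R axis i 1) + s *\<^sub>R axis j 1) -
      partial i \<phi> ((x + \<xi> *\<^sub>R axis i 1) + 0 *\<^sub>R axis j 1) =
      (s - 0) * partial j (partial i \<phi>) ((x + \<xi> *\<^sub>R axis i 1) + \<eta> *\<^sub>R axis j 1)"
    by (rule MVT2) (use s d2 in \<open>auto intro!: has_derivative_along_axis\<close>)
  then obtain \<eta> where \<eta>: "0 < \<eta>" "\<eta> < s" "partial i \<phi> ((x + \<xi> *\<^sub>R axis i 1) + s *\<^sub>R axis j 1) -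
      partial i \<phi> (x + \<xi> *\<^sub>R axis i 1) =
      s * partial j (partial i \<phi>) ((x + \<xi> *\<^sub>R axis i 1) + \<eta> *\<^sub>R axis j 1)"
    by auto
  have "g s - g 0 = s\<^sup>2 * partial j (partial i \<phi>) (x + \<xi> *\<^sub>R axis i 1 + \<eta> *\<^sub>R axis j 1)"
    using \<xi>(3) \<eta>(3) by (simp add: power2_eq_square ac_simps)
  moreover have "\<phi> (x + s *\<^sub>R axis i 1 + s *\<^sub>R axis j 1) - \<phi> (x + s *\<^sub>R axis i 1) -
      \<phi> (x + s *\<^sub>R axis j 1) + \<phi> x = g s - g 0"
    by (simp add: g_def add.assoc add.commute[of "s *\<^sub>R axis j 1"])
  ultimately show ?thesis
    using \<xi>(1,2) \<eta>(1,2) by metis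
qed

text \<open>The symmetric second difference divided by \<open>s^2\<close> tends to either mixed
  derivative as \<open>s\<close> decreases to \<open>0\<close>, by continuity of these derivatives;
  limits are unique.\<close>

lemma partial_commute:
  assumes \<phi>: "C_k 2 \<phi>"
  shows "partial i (partial j \<phi>) x = partial j (partial i \<phi>) x"
proof -
  define \<Delta> where "\<Delta> s = \<phi> (x + s *\<^sub>R axis i 1 + s *\<^sub>R axis j 1) - \<phi> (x + s *\<^sub>R axis i 1) -
      \<phi> (x + s *\<^sub>R axis j 1) + \<phi> x" for s
  have lim: "((\<lambda>s. \<Delta> s / s\<^sup>2) \<longlongrightarrow> partial l (partial k \<phi>) x) (at_right 0)"
    if kl: "(k = i \<and> l = j) \<or> (k = j \<and> l = i)" for k l
  proof (rule tendstoI)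
    fix e :: real assume "e > 0"
    have "isCont (partial l (partial k \<phi>)) x"
      using \<phi> by (simp add: numeral_2_eq_2 continuous_on_eq_continuous_at)
    with \<open>e > 0\<close> obtain \<delta> where "\<delta> > 0" and
      \<delta>: "\<And>y. dist y x < \<delta> \<Longrightarrow> dist (partial l (partial k \<phi>) y) (partial l (partial k \<phi>) x) < e"
      unfolding continuous_at_eps_delta by blast
    \<comment> \<open>The intermediate point is at distance at most
      \<open>\<xi> + \<eta> < 2 * s\<close> from \<open>x\<close>, hence the bound
      \<open>\<delta> / 2\<close> on \<open>s\<close>.\<close>
    have "dist (\<Delta> s / s\<^sup>2) (partial l (partial k \<phi>) x) < e" if s: "0 < s" "s < \<delta> / 2" for s
    proof -
      obtain \<xi> \<eta> where \<xi>\<eta>: "0 < \<xi>" "\<xi> < s" "0 < \<eta>" "\<eta> < s" and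
        eq: "\<phi> (x + s *\<^sub>R axis k 1 + s *\<^sub>R axis l 1) - \<phi> (x + s *\<^sub>R axis k 1) - \<phi> (x + s *\<^sub>R axis l 1) + \<phi> x =
        s\<^sup>2 * partial l (partial k \<phi>) (x + \<xi> *\<^sub>R axis k 1 + \<eta> *\<^sub>R axis l 1)"
        using second_difference_mean_value[OF \<phi> s(1)] by blast
      have "\<Delta> s / s\<^sup>2 = partial l (partial k \<phi>) (x + \<xi> *\<^sub>R axis k 1 + \<eta> *\<^sub>R axis l 1)"
        using kl eq s(1) unfolding \<Delta>_def by (auto simp: field_simps ac_simps)
      moreover have "dist (x + \<xi> *\<^sub>R axis k 1 + \<eta> *\<^sub>R axis l 1) x < \<delta>"
      proof -
        have "norm (\<xi> *\<^sub>R axis k 1 + \<eta> *\<^sub>R axis l (1::real) :: real ^ 3) \<le> \<xi> + \<eta>"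
          using \<xi>\<eta> by (intro order_trans[OF norm_triangle_ineq]) simp
        then show ?thesis using \<xi>\<eta> s by (simp add: dist_norm add.assoc)
      qed
      ultimately show ?thesis using \<delta> by simp
    qed
    then show "\<forall>\<^sub>F s in at_right 0. dist (\<Delta> s / s\<^sup>2) (partial l (partial k \<phi>) x) < e"
      using \<open>\<delta> > 0\<close> by (intro eventually_at_right_less[THEN eventually_mono] eventually_at_rightI[of 0 "\<delta> / 2"]) auto
  qed
  show ?thesis
    using tendsto_unique[OF _ lim[of j i] lim[of i j]] by simp
qed

section \<open>Test functions\<close>

lemma test_functions_C_k: "\<phi> \<in> test_functions \<Omega> \<Longrightarrow> C_k k \<phi>"
  by (simp add: test_functions_def)

lemma test_functions_continuous: "\<phi> \<in> test_functions \<Omega> \<Longrightarrow> continuous_on UNIV \<phi>"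
  using test_functions_C_k C_k_continuous by blast

lemma test_functions_differentiable: "\<phi> \<in> test_functions \<Omega> \<Longrightarrow> \<phi> differentiable_on UNIV"
  using test_functions_C_k[of \<phi> \<Omega> "Suc 0"] by simp

lemma test_functions_support:
  assumes "\<phi> \<in> test_functions \<Omega>"
  obtains K where "compact K" "K \<subseteq> \<Omega>" "\<And>x. x \<notin> K \<Longrightarrow> \<phi> x = 0"
  using assms by (auto simp: test_functions_def)

lemma test_functions_mult_right:
  assumes "\<phi> \<in> test_functions \<Omega>" "\<And>k. C_k k \<psi>"
  shows "(\<lambda>x. \<phi> x * \<psi> x) \<in> test_functions \<Omega>"
proof -
  obtain K where "compact K" "K \<subseteq> \<Omega>" "\<And>x. x \<notin> K \<Longrightarrow> \<phi> x = 0"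
    using test_functions_support[OF assms(1)] by blast
  moreover have "C_k k (\<lambda>x. \<phi> x * \<psi> x)" for k
    by (rule C_k_mult[OF test_functions_C_k[OF assms(1)] assms(2)])
  ultimately show ?thesis
    unfolding test_functions_def by auto
qed

lemma partial_outside_support:
  assumes "compact K" "x \<notin> K" "\<And>x. x \<notin> K \<Longrightarrow> \<phi> x = 0"
  shows "partial i \<phi> x = 0"
proof -
  have "(\<phi> has_derivative (\<lambda>h. 0)) (at x)"
    by (rule has_derivative_transform_within_open[where s="- K" and f="\<lambda>x. 0"])
       (use assms compact_imp_closed in auto)
  then show ?thesis by (simp add: partial_eq)
qed

lemma test_functions_partial:
  assumes "\<phi> \<in> test_functions \<Omega>"
  shows "partial i \<phi> \<in> test_functions \<Omega>"
proof -
  obtain K where "compact K" "K \<subseteq> \<Omega>" "\<And>x. x \<notin> K \<Longrightarrow> \<phi> x = 0"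
    using test_functions_support[OF assms] by blast
  moreover have "C_k k (partial i \<phi>)" for k
    using test_functions_C_k[OF assms, of "Suc k"] by simp
  ultimately show ?thesis
    unfolding test_functions_def using partial_outside_support[of K _ \<phi> i] by blast
qed

lemma compact_support_bounded:
  fixes f :: "'a::topological_space \<Rightarrow> 'b::real_normed_vector"
  assumes "continuous_on UNIV f" "compact K" "\<And>x. x \<notin> K \<Longrightarrow> f x = 0"
  obtains M where "\<And>x. norm (f x) \<le> M"
proof -
  have "compact (f ` K)"
    using assms by (intro compact_continuous_image) (auto intro: continuous_on_subset)
  then obtain M where M: "M > 0" "\<And>y. y \<in> f ` K \<Longrightarrow> norm y \<le> M"
    using compact_imp_bounded bounded_pos by metis
  have "norm (f x) \<le> M" for x
    using M assms(3)[of x] by (cases "x \<in> K") auto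
  then show ?thesis using that by blast
qed

lemma test_functions_bounded:
  assumes "\<phi> \<in> test_functions \<Omega>"
  obtains M where "\<And>x. \<bar>\<phi> x\<bar> \<le> M"
proof -
  obtain K where "compact K" "\<And>x. x \<notin> K \<Longrightarrow> \<phi> x = 0"
    using test_functions_support[OF assms] by metis
  from compact_support_bounded[OF test_functions_continuous[OF assms] this]
  show ?thesis using that by auto
qed

lemma borel_measurable_lebesgue_on_continuous:
  assumes "continuous_on UNIV (f :: 'a::euclidean_space \<Rightarrow> 'b::euclidean_space)"
  shows "f \<in> borel_measurable (lebesgue_on \<Omega>)"
  by (intro measurable_restrict_space1 measurable_completion)
     (simp add: borel_measurable_continuous_onI[OF assms])

lemma test_functions_L2:
  assumes "\<Omega> \<in> lmeasurable" "\<phi> \<in> test_functions \<Omega>"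
  shows "\<phi> \<in> L2 \<Omega>"
proof -
  obtain M where "\<And>x. \<bar>\<phi> x\<bar> \<le> M"
    using test_functions_bounded[OF assms(2)] by blast
  then show ?thesis
    using assms by (intro L2_bounded[where M=M] borel_measurable_lebesgue_on_continuous)
                   (auto intro: test_functions_continuous)
qed

lemma classical_grad_L2:
  assumes "\<Omega> \<in> lmeasurable" "\<phi> \<in> test_functions \<Omega>"
  shows "classical_grad \<phi> \<in> L2 \<Omega>"
  using L2_vec_lambda[of "\<lambda>i. partial i \<phi>" \<Omega>] test_functions_L2[OF assms(1) test_functions_partial[OF assms(2)]]
  by (simp add: classical_grad_def[abs_def])

section \<open>Integration of compactly supported functions\<close>

text \<open>Passes from the measure that defines the spaces to \<open>lborel\<close>, where
  translation invariance is exploited.\<close>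

lemma integral_lebesgue_on_eq_lborel:
  fixes f :: "'a::euclidean_space \<Rightarrow> real"
  assumes \<Omega>: "\<Omega> \<in> sets lebesgue" and f: "f \<in> borel_measurable borel"
    and supp: "\<And>x. x \<notin> \<Omega> \<Longrightarrow> f x = 0"
  shows "integral\<^sup>L (lebesgue_on \<Omega>) f = integral\<^sup>L lborel f"
proof -
  have "integral\<^sup>L (lebesgue_on \<Omega>) f = integral\<^sup>L lebesgue (\<lambda>x. indicator \<Omega> x *\<^sub>R f x)"
    using \<Omega> by (intro integral_restrict_space) simp
  also have "(\<lambda>x. indicator \<Omega> x *\<^sub>R f x) = f"
    using supp by (auto simp: fun_eq_iff indicator_def)
  finally show ?thesis
    using f by (simp add: integral_completion)
qed

lemma integrable_compact_support:
  fixes f :: "'a::euclidean_space \<Rightarrow> real"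
  assumes f: "continuous_on UNIV f" and K: "compact K" "\<And>x. x \<notin> K \<Longrightarrow> f x = 0"
  shows "integrable lborel f"
proof -
  have eq: "f = (\<lambda>x. indicator K x *\<^sub>R f x)"
    using K by (auto simp: fun_eq_iff indicator_def)
  show ?thesis
    by (subst eq) (rule borel_integrable_compact[OF K(1) continuous_on_subset[OF f subset_UNIV]])
qed

text \<open>Difference quotients have integral zero by translation invariance.\<close>

lemma integral_partial_zero:
  assumes C1: "C_k 1 \<psi>" and K: "compact K" "\<And>x. x \<notin> K \<Longrightarrow> \<psi> x = 0"
  shows "integral\<^sup>L lborel (partial i \<psi>) = 0"
proof -
  let ?a = "axis i 1 :: real ^ 3"
  have d: "\<psi> differentiable_on UNIV" and c: "continuous_on UNIV (partial i \<psi>)"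
    using C1 by simp_all
  have c0: "continuous_on UNIV \<psi>" using C_k_continuous[OF C1] .
  have "partial i \<psi> x = 0" if "x \<notin> K" for x
    using partial_outside_support[OF K(1) that] K(2) by blast
  then obtain M where M: "\<And>x. norm (partial i \<psi> x) \<le> M"
    using compact_support_bounded[OF c K(1)] by blast
  obtain R where R: "R > 0" "\<And>x. x \<in> K \<Longrightarrow> norm x \<le> R"
    using compact_imp_bounded[OF K(1)] bounded_pos by metis
  \<comment> \<open>Increments of at most \<open>1\<close> keep the supports of all difference
    quotients in the ball of radius \<open>R + 1\<close>.\<close>
  define e where "e n = 1 / real (Suc n)" for n
  have e: "0 < e n" "e n \<le> 1" for n by (auto simp: e_def)
  define q where "q n x = (\<psi> (e n *\<^sub>R ?a + x) - \<psi> x) / e n" for n x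
  have line: "((\<lambda>t. \<psi> (t *\<^sub>R ?a + x)) has_real_derivative partial i \<psi> (t *\<^sub>R ?a + x)) (at t)" for x t
    using has_derivative_along_axis[OF d, of x i t] by (simp add: add.commute)
  have int_\<psi>: "integrable lborel \<psi>"
    by (rule integrable_compact_support[OF c0 K])
  have shift: "integrable lborel (\<lambda>x. \<psi> (y + x))" "(\<integral>x. \<psi> (y + x) \<partial>lborel) = integral\<^sup>L lborel \<psi>" for y
  proof -
    have m: "\<psi> \<in> borel_measurable borel" using c0 by (rule borel_measurable_continuous_onI)
    have "integral\<^sup>L (distr lborel borel ((+) y)) \<psi> = (\<integral>x. \<psi> (y + x) \<partial>lborel)"
      using m by (intro integral_distr) auto
    then show "(\<integral>x. \<psi> (y + x) \<partial>lborel) = integral\<^sup>L lborel \<psi>"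
      by (simp add: lborel_distr_plus)
    have "integrable (distr lborel borel ((+) y)) \<psi> \<longleftrightarrow> integrable lborel (\<lambda>x. \<psi> (y + x))"
      using m by (intro integrable_distr_eq) auto
    then show "integrable lborel (\<lambda>x. \<psi> (y + x))"
      using int_\<psi> by (simp add: lborel_distr_plus)
  qed
  have q0: "integral\<^sup>L lborel (q n) = 0" for n
    unfolding q_def using shift int_\<psi> by simp
  \<comment> \<open>By the mean value theorem the quotients are bounded by \<open>M\<close>, so
    \<open>M\<close> times the indicator of that ball is an integrable majorant.\<close>
  have "(\<lambda>n. integral\<^sup>L lborel (q n)) \<longlonglongrightarrow> integral\<^sup>L lborel (partial i \<psi>)"
  proof (rule integral_dominated_convergence[where w="\<lambda>x. M * indicator (cball 0 (R + 1)) x"])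
    show "partial i \<psi> \<in> borel_measurable lborel"
      using c by (simp add: borel_measurable_continuous_onI)
    show "q n \<in> borel_measurable lborel" for n
      unfolding q_def using shift(1) int_\<psi> by (intro borel_measurable_divide borel_measurable_diff) auto
    show "integrable lborel (\<lambda>x. M * indicator (cball 0 (R + 1)) x :: real)"
      by (intro integrable_mult_right integrable_real_indicator) (use emeasure_bounded_finite[OF bounded_cball] in auto)
    show "AE x in lborel. (\<lambda>n. q n x) \<longlonglongrightarrow> partial i \<psi> x"
    proof (rule AE_I2)
      fix x
      have "((\<lambda>h. (\<psi> (h *\<^sub>R ?a + x) - \<psi> (0 *\<^sub>R ?a + x)) / (h - 0)) \<longlongrightarrow> partial i \<psi> (0 *\<^sub>R ?a + x)) (at 0)"
        using line[of x 0] by (simp add: has_field_derivative_iff)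
      moreover have "filterlim e (at 0) sequentially"
        unfolding filterlim_at e_def using lim_1_over_n[THEN LIMSEQ_Suc] by auto
      ultimately have "(\<lambda>n. (\<psi> (e n *\<^sub>R ?a + x) - \<psi> (0 *\<^sub>R ?a + x)) / (e n - 0)) \<longlonglongrightarrow> partial i \<psi> (0 *\<^sub>R ?a + x)"
        by (rule filterlim_compose)
      then show "(\<lambda>n. q n x) \<longlonglongrightarrow> partial i \<psi> x" by (simp add: q_def)
    qed
    show "AE x in lborel. norm (q n x) \<le> M * indicator (cball 0 (R + 1)) x" for n
    proof (rule AE_I2)
      fix x
      have "\<exists>z>0. z < e n \<and> \<psi> (e n *\<^sub>R ?a + x) - \<psi> (0 *\<^sub>R ?a + x) = (e n - 0) * partial i \<psi> (z *\<^sub>R ?a + x)"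
        by (rule MVT2) (use e line in auto)
      then have "norm (q n x) \<le> M"
        using e(1)[of n] M by (auto simp: q_def abs_mult)
      moreover have "q n x = 0" if "x \<notin> cball 0 (R + 1)"
      proof -
        have "norm x \<le> norm (e n *\<^sub>R ?a + x) + norm (e n *\<^sub>R ?a)"
          using norm_triangle_ineq4[of "e n *\<^sub>R ?a + x" "e n *\<^sub>R ?a"] by simp
        then have "norm (e n *\<^sub>R ?a + x) > R"
          using that e[of n] by simp
        then have "e n *\<^sub>R ?a + x \<notin> K" "x \<notin> K"
          using R that by force+
        then show ?thesis using K(2) by (simp add: q_def)
      qed
      ultimately show "norm (q n x) \<le> M * indicator (cball 0 (R + 1)) x"
        by (auto simp: indicator_def)
    qed
  qed
  then show ?thesis using q0 by (simp add: LIMSEQ_const_iff)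
qed

text \<open>The function \<open>\<psi> = \<phi>^2 x_i\<close> has compact support, so the integral
  of its \<open>i\<close>-th partial derivative vanishes. This expresses the square of the norm of
  \<open>\<phi>\<close> as \<open>-2\<close> times the inner product of \<open>\<phi>\<close> with
  \<open>x_i\<close> times its \<open>i\<close>-th derivative. Cauchy-Schwarz and
  \<open>\<bar>x_i\<bar> \<le> R\<close> then leave one norm of \<open>\<phi>\<close> to cancel. A
  single coordinate direction suffices.\<close>

lemma test_functions_Poincare:
  assumes \<Omega>: "\<Omega> \<in> lmeasurable" and R: "\<And>x. x \<in> \<Omega> \<Longrightarrow> norm x \<le> R" "R \<ge> 0"
    and \<phi>: "\<phi> \<in> test_functions \<Omega>"
  shows "l2_norm \<Omega> \<phi> \<le> 2 * R * l2_norm \<Omega> (classical_grad \<phi>)"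
proof -
  fix i :: 3
  obtain K where K: "compact K" "K \<subseteq> \<Omega>" "\<And>x. x \<notin> K \<Longrightarrow> \<phi> x = 0"
    using test_functions_support[OF \<phi>] by blast
  define \<psi> where "\<psi> x = (\<phi> x * \<phi> x) * x $ i" for x
  have C: "C_k 1 \<psi>"
    unfolding \<psi>_def by (intro C_k_mult C_k_coordinate test_functions_C_k[OF \<phi>])
  note d = test_functions_differentiable[OF \<phi>]
  have dx: "(\<lambda>x::real^3. x $ i) differentiable_on UNIV"
    using C_k_coordinate[of "Suc 0" i] by simp
  have "partial i (\<lambda>x. x $ i) = (\<lambda>x. 1)"
    by (rule ext) (simp add: partial_eq[OF bounded_linear_imp_has_derivative[OF bounded_linear_vec_nth]])
  then have p: "partial i \<psi> x = \<phi> x * \<phi> x + 2 * (\<phi> x * (x $ i * partial i \<phi> x))" for x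
    unfolding \<psi>_def using d dx
    by (simp add: partial_mult differentiable_on_mult algebra_simps)
  have L: "\<phi> \<in> L2 \<Omega>" "partial i \<phi> \<in> L2 \<Omega>"
    using test_functions_L2[OF \<Omega>] \<phi> test_functions_partial[OF \<phi>] by auto
  have bound: "AE x in lebesgue_on \<Omega>. \<bar>x $ i\<bar> \<le> R"
    using R component_le_norm_cart by (intro AE_I2) (auto intro: order_trans)
  have Lx: "(\<lambda>x. x $ i * partial i \<phi> x) \<in> L2 \<Omega>"
    using L2_bounded_scaleR[OF L(2) _ bound]
    by (simp add: borel_measurable_lebesgue_on_continuous continuous_intros)
  have "continuous_on UNIV (partial i \<psi>)" using C by simp
  moreover have "partial i \<psi> x = 0" if "x \<notin> \<Omega>" for x
  proof -
    have "\<phi> x = 0" using K(2,3) that by blast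
    then show ?thesis by (simp add: p)
  qed
  ultimately have "integral\<^sup>L (lebesgue_on \<Omega>) (partial i \<psi>) = integral\<^sup>L lborel (partial i \<psi>)"
    using \<Omega> by (intro integral_lebesgue_on_eq_lborel borel_measurable_continuous_onI) auto
  also have "\<dots> = 0"
    by (rule integral_partial_zero[OF C K(1)]) (simp add: \<psi>_def K(3))
  finally have "l2_inner \<Omega> \<phi> \<phi> + 2 * l2_inner \<Omega> \<phi> (\<lambda>x. x $ i * partial i \<phi> x) = 0"
    unfolding p[abs_def] l2_inner_def
    using L2_inner_integrable[OF L(1) L(1)] L2_inner_integrable[OF L(1) Lx] by simp
  then have sq: "(l2_norm \<Omega> \<phi>)\<^sup>2 \<le> 2 * (l2_norm \<Omega> \<phi> * l2_norm \<Omega> (\<lambda>x. x $ i * partial i \<phi> x))"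
    using l2_Cauchy_Schwarz[OF L(1) Lx] by (simp add: l2_norm_sq)
  have "l2_norm \<Omega> (\<lambda>x. x $ i * partial i \<phi> x) \<le> l2_norm \<Omega> (\<lambda>x. R *\<^sub>R classical_grad \<phi> x)"
  proof (rule l2_norm_mono[OF Lx L2_scaleR[OF classical_grad_L2[OF \<Omega> \<phi>]]])
    have le: "\<bar>partial i \<phi> x\<bar> \<le> norm (classical_grad \<phi> x)" for x
      using component_le_norm_cart[of "classical_grad \<phi> x" i] by (simp add: classical_grad_def)
    show "AE x in lebesgue_on \<Omega>. norm (x $ i * partial i \<phi> x) \<le> norm (R *\<^sub>R classical_grad \<phi> x)"
      using bound by eventually_elim (use R(2) le in \<open>auto simp: abs_mult intro: mult_mono\<close>)
  qed
  also have "l2_norm \<Omega> (\<lambda>x. R *\<^sub>R classical_grad \<phi> x) = R * l2_norm \<Omega> (classical_grad \<phi>)"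
    using R(2) by (simp add: l2_norm_scaleR)
  finally have "l2_norm \<Omega> \<phi> * l2_norm \<Omega> (\<lambda>x. x $ i * partial i \<phi> x)
      \<le> l2_norm \<Omega> \<phi> * (R * l2_norm \<Omega> (classical_grad \<phi>))"
    by (rule mult_left_mono) simp
  with sq have "l2_norm \<Omega> \<phi> * l2_norm \<Omega> \<phi> \<le> l2_norm \<Omega> \<phi> * (2 * R * l2_norm \<Omega> (classical_grad \<phi>))"
    by (simp add: power2_eq_square)
  then show ?thesis
    using R(2) l2_norm_nonneg[of \<Omega> \<phi>] by (cases "l2_norm \<Omega> \<phi> = 0") (auto simp: mult_le_cancel_left)
qed

section \<open>The fundamental lemma of the calculus of variations\<close>

lemma flat_one: "flat 1 t = (if t > 0 then exp (- (1 / t)) else 0)"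
  by (simp add: flat_def)

lemma flat_one_bounds: "0 \<le> flat 1 t" "flat 1 t \<le> 1"
  by (simp_all add: flat_one)

text \<open>A smooth bump on the open box with a steepness parameter: for \<open>c > 0\<close> each
  factor vanishes outside the open interval, and inside it tends to \<open>1\<close> as
  \<open>c\<close> grows. The bumps therefore approximate the indicator of the open box.\<close>

definition box_bump :: "real \<Rightarrow> real ^ 3 \<Rightarrow> real ^ 3 \<Rightarrow> scalar_field" where
  "box_bump c a b x = (\<Prod>i\<in>UNIV. flat 1 (c * (x $ i - a $ i)) * flat 1 (c * (b $ i - x $ i)))"

lemma C_k_box_bump: "C_k k (box_bump c a b)"
proof -
  have "C_k k (\<lambda>x. flat 1 (c * x $ i + (- c * a $ i)) * flat 1 (- c * x $ i + c * b $ i))" for i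
    by (intro C_k_mult C_k_flat)
  then have "C_k k (\<lambda>x. flat 1 (c * (x $ i - a $ i)) * flat 1 (c * (b $ i - x $ i)))" for i
    by (simp add: algebra_simps)
  then show ?thesis
    unfolding box_bump_def[abs_def] by (rule C_k_prod)
qed

lemma box_bump_bounds: "0 \<le> box_bump c a b x" "box_bump c a b x \<le> 1"
  unfolding box_bump_def
  by (intro prod_nonneg ballI mult_nonneg_nonneg flat_one_bounds prod_le_1 conjI mult_le_one)+

lemma box_bump_pos: "c > 0 \<Longrightarrow> x \<in> box a b \<Longrightarrow> box_bump c a b x > 0"
  unfolding box_bump_def by (intro prod_pos) (auto simp: mem_box_cart flat_one)

lemma box_bump_outside:
  assumes "c > 0" "x \<notin> box a b"
  shows "box_bump c a b x = 0"
proof -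
  obtain i where "\<not> (a $ i < x $ i \<and> x $ i < b $ i)"
    using assms(2) by (auto simp: mem_box_cart)
  then have "flat 1 (c * (x $ i - a $ i)) * flat 1 (c * (b $ i - x $ i)) = 0"
    using assms(1) by (auto simp: flat_one zero_less_mult_iff)
  then show ?thesis
    unfolding box_bump_def by (intro prod_zero) auto
qed

lemma box_bump_test_function:
  assumes "c > 0" "cbox a b \<subseteq> \<Omega>"
  shows "box_bump c a b \<in> test_functions \<Omega>"
proof -
  have "box_bump c a b x = 0" if "x \<notin> cbox a b" for x
    using that box_bump_outside[OF assms(1)] box_subset_cbox by blast
  then show ?thesis
    unfolding test_functions_def mem_Collect_eq using assms(2)
    by (intro conjI allI C_k_box_bump exI[of _ "cbox a b"] compact_cbox impI)
qed

lemma flat_one_tendsto_1: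
  assumes "t > 0"
  shows "(\<lambda>n. flat 1 (real (Suc n) * t)) \<longlonglongrightarrow> 1"
proof -
  have "(\<lambda>n. exp (- (1 / real (Suc n) * (1 / t)))) \<longlonglongrightarrow> exp (- (0 * (1 / t)))"
    by (intro tendsto_intros LIMSEQ_Suc[OF lim_1_over_n])
  then show ?thesis
    using assms by (simp add: flat_one)
qed

lemma box_bump_tendsto_indicator:
  "(\<lambda>n. box_bump (real (Suc n)) a b x) \<longlonglongrightarrow> indicator (box a b) x"
proof (cases "x \<in> box a b")
  case True
  then have "(\<lambda>n. box_bump (real (Suc n)) a b x) \<longlonglongrightarrow> (\<Prod>i\<in>(UNIV::3 set). 1 * 1)"
    unfolding box_bump_def
    by (intro tendsto_prod tendsto_mult flat_one_tendsto_1) (auto simp: mem_box_cart)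
  then show ?thesis using True by simp
next
  case False
  then show ?thesis by (simp add: box_bump_outside)
qed

section \<open>From vanishing integrals to vanishing functions\<close>

text \<open>Dynkin's argument: open boxes are an intersection-stable generator of the Borel sets,
  and the sets over which \<open>f\<close> integrates to zero are closed under complements and
  countable disjoint unions. A function with zero integral over every Borel set vanishes almost
  everywhere.\<close>

lemma AE_zero_if_box_integrals_zero:
  fixes f :: "'a::euclidean_space \<Rightarrow> real"
  assumes f: "integrable lborel f"
    and box: "\<And>a b. (\<integral>x. indicator (box a b) x * f x \<partial>lborel) = 0"
  shows "AE x in lborel. f x = 0"
proof (rule sigma_finite_measure.density_zero[OF sigma_finite_lborel f])
  have int: "integrable lborel (\<lambda>x. indicator A x * f x)" if "A \<in> sets borel" for A
    using integrable_mult_indicator[of A lborel f] f that by simp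
  have bdd: "AE x in lborel. norm (indicator A x * f x) \<le> norm (f x)" for A
    by (auto simp: indicator_def)
  \<comment> \<open>Needed for complements: the whole space is the limit of the growing boxes
    \<open>(-n, n)^d\<close>, with \<open>\<bar>f\<bar>\<close> as majorant.\<close>
  have total: "(\<integral>x. f x \<partial>lborel) = 0"
  proof -
    have "(\<lambda>n. \<integral>x. indicator (box (- (real n *\<^sub>R One)) (real n *\<^sub>R One)) x * f x \<partial>lborel) \<longlonglongrightarrow> (\<integral>x. f x \<partial>lborel)"
    proof (rule integral_dominated_convergence[where w="\<lambda>x. norm (f x)", OF _ _ _ _ bdd])
      show "AE x in lborel. (\<lambda>n. indicator (box (- (real n *\<^sub>R One)) (real n *\<^sub>R One)) x * f x) \<longlonglongrightarrow> f x"
      proof (rule AE_I2)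
        fix x :: 'a
        obtain N :: nat where N: "norm x < real N" using reals_Archimedean2 by blast
        have "x \<in> box (- (real n *\<^sub>R One)) (real n *\<^sub>R One)" if "n \<ge> N" for n
        proof -
          have "\<bar>x \<bullet> i\<bar> < real n" if "i \<in> Basis" for i
            using Basis_le_norm[OF that, of x] N \<open>n \<ge> N\<close> by simp
          then show ?thesis by (force simp: mem_box abs_less_iff)
        qed
        then show "(\<lambda>n. indicator (box (- (real n *\<^sub>R One)) (real n *\<^sub>R One)) x * f x) \<longlonglongrightarrow> f x"
          by (intro tendsto_eventually eventually_sequentiallyI[of N]) simp
      qed
    qed (use f int in auto)
    then show ?thesis by (simp add: box LIMSEQ_const_iff)
  qed
  fix A :: "'a set" assume "A \<in> sets lborel"
  then have A: "A \<in> sigma_sets UNIV (range (\<lambda>(a, b). box a b))"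
    by (simp add: borel_eq_box)
  have stable: "Int_stable (range (\<lambda>(a, b). box a b :: 'a set))"
    unfolding Int_stable_def by (auto simp: box_Int_box)
  have subset_Pow: "range (\<lambda>(a, b). box a b :: 'a set) \<subseteq> Pow UNIV"
    by simp
  from A have "(\<integral>x. indicator A x * f x \<partial>lborel) = 0"
  proof (induction A rule: sigma_sets_induct_disjoint[OF stable subset_Pow, consumes 1, case_names basic empty compl union])
    case (basic A)
    then show ?case using box by auto
  next
    case empty
    show ?case by simp
  next
    case (compl A)
    then have "A \<in> sets borel" by (simp add: borel_eq_box)
    moreover have "indicator (UNIV - A) x * f x = f x - indicator A x * f x" for x
      by (simp add: indicator_def)
    ultimately show ?case using f int compl total by simp
  next
    case (union A)
    then have A: "A i \<in> sets borel" for i by (auto simp: borel_eq_box)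
    have "set_lebesgue_integral lborel (\<Union>i. A i) f = (\<Sum>i. set_lebesgue_integral lborel (A i) f)"
    proof (rule lebesgue_integral_countable_add)
      show "A i \<in> sets lborel" for i using A by simp
      show "A i \<inter> A j = {}" if "i \<noteq> j" for i j
        using union(1) that by (auto simp: disjoint_family_on_def)
      have "(\<Union>i. A i) \<in> sets borel" using A by auto
      then show "set_integrable lborel (\<Union>i. A i) f"
        using int by (simp add: set_integrable_def)
    qed
    then show ?case using union by (simp add: set_lebesgue_integral_def)
  qed
  then show "set_lebesgue_integral lborel A f = 0"
    by (simp add: set_lebesgue_integral_def)
qed

text \<open>On a closed box inside \<open>\<Omega>\<close>, \<open>d\<close> is multiplied by a
  fixed bump \<open>\<eta>\<close>. Testing with \<open>\<eta>\<close> times ever steeper bumps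
  shows in the limit that \<open>d * \<eta>\<close> has zero integral over every open box, hence
  \<open>d * \<eta> = 0\<close> almost everywhere. Countably many such boxes cover
  \<open>\<Omega>\<close>.\<close>

lemma fundamental_lemma_of_variations:
  assumes \<Omega>: "open \<Omega>" "\<Omega> \<in> lmeasurable" and d: "d \<in> L2 \<Omega>"
    and zero: "\<And>\<phi>. \<phi> \<in> test_functions \<Omega> \<Longrightarrow> l2_inner \<Omega> d \<phi> = 0"
  shows "AE x in lebesgue_on \<Omega>. d x = 0"
proof -
  have \<Omega>': "\<Omega> \<inter> space lebesgue \<in> sets lebesgue" using \<Omega> by simp
  have local: "AE x in lebesgue_on \<Omega>. x \<in> cbox a b \<longrightarrow> d x = 0" if ab: "cbox a b \<subseteq> \<Omega>" for a b
  proof -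
    \<comment> \<open>The boxes \<open>box p q\<close> below need not lie in
      \<open>\<Omega>\<close>. The factor \<open>\<eta>\<close> still makes the product with their
      bumps a test function on \<open>\<Omega>\<close>.\<close>
    define \<eta> where "\<eta> = box_bump 1 a b"
    have \<eta>: "\<eta> \<in> test_functions \<Omega>"
      unfolding \<eta>_def using ab by (intro box_bump_test_function) auto
    have int: "integrable (lebesgue_on \<Omega>) (\<lambda>x. d x * \<eta> x)"
      using L2_inner_integrable[OF d test_functions_L2[OF \<Omega>(2) \<eta>]] by simp
    define g where "g x = indicator \<Omega> x * (d x * \<eta> x)" for x
    have g: "integrable lebesgue g"
      using int integrable_restrict_space[OF \<Omega>', of "\<lambda>x. d x * \<eta> x"] by (simp add: g_def[abs_def])
    \<comment> \<open>\<open>g\<close> extends \<open>d * \<eta>\<close> by zero and is only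
      Lebesgue measurable; the criterion with boxes is applied to a Borel representative.\<close>
    obtain g' where g': "g' \<in> borel_measurable lborel" "AE x in lborel. g x = g' x"
      using completion_ex_borel_measurable_real[of g lborel] g by auto
    have AE_g: "AE x in lebesgue. g x = g' x"
      using g'(2) by (rule AE_completion)
    have g'_meas: "g' \<in> borel_measurable lebesgue"
      using g'(1) by (rule measurable_completion)
    have int_g': "integrable lborel g'"
      using integrable_cong_AE_imp[OF g g'_meas] AE_g g'(1) integrable_completion[of g' lborel]
      by (simp add: eq_commute)
    have "(\<integral>x. indicator (box p q) x * g' x \<partial>lborel) = 0" for p q
    proof -
      have "(\<lambda>n. integral\<^sup>L (lebesgue_on \<Omega>) (\<lambda>x. box_bump (real (Suc n)) p q x * (d x * \<eta> x)))
          \<longlonglongrightarrow> integral\<^sup>L (lebesgue_on \<Omega>) (\<lambda>x. indicator (box p q) x * (d x * \<eta> x))"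
      proof (rule integral_dominated_convergence[where w="\<lambda>x. norm (d x * \<eta> x)"])
        show "AE x in lebesgue_on \<Omega>. (\<lambda>n. box_bump (real (Suc n)) p q x * (d x * \<eta> x)) \<longlonglongrightarrow>
            indicator (box p q) x * (d x * \<eta> x)"
          by (intro AE_I2 tendsto_mult tendsto_const box_bump_tendsto_indicator)
        show "AE x in lebesgue_on \<Omega>. norm (box_bump (real (Suc n)) p q x * (d x * \<eta> x)) \<le> norm (d x * \<eta> x)" for n
          using box_bump_bounds[of "real (Suc n)" p q] by (intro AE_I2) (simp add: abs_mult mult_left_le_one_le)
        show "(\<lambda>x. box_bump (real (Suc n)) p q x * (d x * \<eta> x)) \<in> borel_measurable (lebesgue_on \<Omega>)" for n
          by (intro borel_measurable_times borel_measurable_integrable[OF int]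
              borel_measurable_lebesgue_on_continuous C_k_continuous[OF C_k_box_bump])
        have "box p q \<in> sets lebesgue" by simp
        then have "indicator (box p q) \<in> borel_measurable (lebesgue_on \<Omega>)"
          by (intro measurable_restrict_space1 borel_measurable_indicator)
        then show "(\<lambda>x. indicator (box p q) x * (d x * \<eta> x)) \<in> borel_measurable (lebesgue_on \<Omega>)"
          by (intro borel_measurable_times borel_measurable_integrable[OF int])
      qed (use int in auto)
      moreover have "integral\<^sup>L (lebesgue_on \<Omega>) (\<lambda>x. box_bump (real (Suc n)) p q x * (d x * \<eta> x)) = 0" for n
        using zero[OF test_functions_mult_right[OF \<eta> C_k_box_bump], of "real (Suc n)" p q]
        by (simp add: l2_inner_def ac_simps)
      ultimately have "integral\<^sup>L (lebesgue_on \<Omega>) (\<lambda>x. indicator (box p q) x * (d x * \<eta> x)) = 0"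
        by (simp add: LIMSEQ_const_iff)
      then have "integral\<^sup>L lebesgue (\<lambda>x. indicator (box p q) x * g x) = 0"
        using integral_restrict_space[OF \<Omega>', of "\<lambda>x. indicator (box p q) x * (d x * \<eta> x)"]
        by (simp add: g_def[abs_def] ac_simps)
      moreover have "integral\<^sup>L lebesgue (\<lambda>x. indicator (box p q) x * g x) =
          integral\<^sup>L lebesgue (\<lambda>x. indicator (box p q) x * g' x)"
      proof (rule integral_cong_AE)
        have "indicator (box p q) \<in> borel_measurable lebesgue"
          by (intro borel_measurable_indicator) simp
        then show "(\<lambda>x. indicator (box p q) x * g x) \<in> borel_measurable lebesgue"
          "(\<lambda>x. indicator (box p q) x * g' x) \<in> borel_measurable lebesgue"
          using borel_measurable_integrable[OF g] g'_meas by (intro borel_measurable_times; simp)+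
      qed (use AE_g in eventually_elim, simp)
      moreover have "integral\<^sup>L lebesgue (\<lambda>x. indicator (box p q) x * g' x) =
          integral\<^sup>L lborel (\<lambda>x. indicator (box p q) x * g' x)"
        using g'(1) by (intro integral_completion) auto
      ultimately show ?thesis by simp
    qed
    then have "AE x in lborel. g' x = 0"
      by (rule AE_zero_if_box_integrals_zero[OF int_g'])
    then have "AE x in lebesgue. g' x = 0"
      by (rule AE_completion)
    \<comment> \<open>\<open>\<eta>\<close> is positive only on the open box, so the boundary of the
      closed box is discarded as a null set before dividing by \<open>\<eta>\<close>.\<close>
    moreover have "AE x in lebesgue. x \<notin> cbox a b - box a b"
      using negligible_frontier_interval by (intro AE_not_in) (simp add: negligible_iff_null_sets)
    ultimately have "AE x in lebesgue. x \<in> \<Omega> \<longrightarrow> (x \<in> cbox a b \<longrightarrow> d x = 0)"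
      using AE_g
    proof eventually_elim
      case (elim x)
      then show ?case
        using box_bump_pos[of 1 x a b] by (auto simp: g_def \<eta>_def)
    qed
    then show ?thesis
      by (subst AE_restrict_space_iff[OF \<Omega>'])
  qed
  \<comment> \<open>A countable cover keeps the union of the exceptional sets null.\<close>
  obtain D where D: "countable D" "D \<subseteq> Pow \<Omega>" "\<And>X. X \<in> D \<Longrightarrow> \<exists>a b. X = cbox a b" "\<Union>D = \<Omega>"
    using open_countable_Union_open_cbox[OF \<Omega>(1)] by metis
  have "AE x in lebesgue_on \<Omega>. \<forall>X\<in>D. x \<in> X \<longrightarrow> d x = 0"
  proof (subst AE_ball_countable[OF D(1)], rule ballI)
    fix X assume "X \<in> D"
    then obtain a b where "X = cbox a b" "cbox a b \<subseteq> \<Omega>" using D(2,3) by fast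
    then show "AE x in lebesgue_on \<Omega>. x \<in> X \<longrightarrow> d x = 0" using local by simp
  qed
  moreover have "AE x in lebesgue_on \<Omega>. x \<in> \<Union>D"
    using D(4) by (intro AE_I2) simp
  ultimately show ?thesis
    by eventually_elim blast
qed

section \<open>Weak derivatives and Sobolev spaces\<close>

lemma is_weak_grad_weak_grad: "u \<in> H1 \<Omega> \<Longrightarrow> is_weak_grad \<Omega> u (weak_grad \<Omega> u)"
  unfolding weak_grad_def H1_def using someI_ex[of "is_weak_grad \<Omega> u"] by blast

lemma is_weak_curl_weak_curl: "u \<in> Hcurl \<Omega> \<Longrightarrow> is_weak_curl \<Omega> u (weak_curl \<Omega> u)"
  unfolding weak_curl_def Hcurl_def using someI_ex[of "is_weak_curl \<Omega> u"] by blast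

text \<open>Stated for a witness \<open>d\<close> instead of membership in \<open>Hdiv\<close>, so
  that it applies as soon as a candidate such as the trace of the Jacobian is known.\<close>

lemma is_weak_div_weak_div: "is_weak_div \<Omega> u d \<Longrightarrow> is_weak_div \<Omega> u (weak_div \<Omega> u)"
  unfolding weak_div_def by (rule someI[of "is_weak_div \<Omega> u"])

lemma weak_grad_L2: "u \<in> H1 \<Omega> \<Longrightarrow> weak_grad \<Omega> u \<in> L2 \<Omega>"
  using is_weak_grad_weak_grad is_weak_grad_def by blast

lemma weak_curl_L2: "u \<in> Hcurl \<Omega> \<Longrightarrow> weak_curl \<Omega> u \<in> L2 \<Omega>"
  using is_weak_curl_weak_curl is_weak_curl_def by blast

lemma weak_div_L2: "is_weak_div \<Omega> u d \<Longrightarrow> weak_div \<Omega> u \<in> L2 \<Omega>"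
  using is_weak_div_weak_div is_weak_div_def by blast

lemma H1_0_D: "u \<in> H1_0 \<Omega> \<Longrightarrow> u \<in> H1 \<Omega>" "u \<in> H1_0 \<Omega> \<Longrightarrow> u \<in> L2 \<Omega>"
  by (simp_all add: H1_0_def H1_def)

lemma H1v_0_D: "u \<in> H1v_0 \<Omega> \<Longrightarrow> (\<lambda>x. u x $ i) \<in> H1_0 \<Omega>"
  by (simp add: H1v_0_def)

lemma H1v_0_L2:
  assumes "u \<in> H1v_0 \<Omega>"
  shows "u \<in> L2 \<Omega>"
  using L2_vec_lambda[of "\<lambda>i x. u x $ i" \<Omega>] H1_0_D(2)[OF H1v_0_D[OF assms]] by simp

lemma weak_jac_L2:
  assumes "u \<in> H1v_0 \<Omega>"
  shows "weak_jac \<Omega> u \<in> L2 \<Omega>"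
  using L2_vec_lambda[of "\<lambda>i. weak_grad \<Omega> (\<lambda>y. u y $ i)" \<Omega>]
    weak_grad_L2[OF H1_0_D(1)[OF H1v_0_D[OF assms]]]
  by (simp add: weak_jac_def[abs_def])

lemma l2_norm_weak_jac_sq:
  assumes "u \<in> H1v_0 \<Omega>"
  shows "(l2_norm \<Omega> (weak_jac \<Omega> u))\<^sup>2 = (\<Sum>i\<in>UNIV. (l2_norm \<Omega> (weak_grad \<Omega> (\<lambda>x. u x $ i)))\<^sup>2)"
  using l2_norm_sq_components[OF weak_jac_L2[OF assms]] by (simp add: weak_jac_def)

text \<open>Ensures that \<open>weak_div \<Omega> u\<close> is a genuine weak divergence for a
  velocity field, not an arbitrary choice: the weak partial derivatives of the components are
  summed.\<close>

lemma is_weak_div_trace_weak_jac: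
  assumes \<Omega>: "\<Omega> \<in> lmeasurable" and u: "u \<in> H1v_0 \<Omega>"
  shows "is_weak_div \<Omega> u (\<lambda>x. \<Sum>i\<in>UNIV. weak_jac \<Omega> u x $ i $ i)"
  unfolding is_weak_div_def
proof (intro conjI ballI)
  have L: "(\<lambda>x. weak_jac \<Omega> u x $ i $ i) \<in> L2 \<Omega>" for i
    by (intro L2_component weak_jac_L2 u)
  show "(\<lambda>x. \<Sum>i\<in>UNIV. weak_jac \<Omega> u x $ i $ i) \<in> L2 \<Omega>"
    unfolding sum_3 by (intro L2_add L)
  fix \<phi> assume \<phi>: "\<phi> \<in> test_functions \<Omega>"
  note L\<phi> = test_functions_L2[OF \<Omega> \<phi>] test_functions_L2[OF \<Omega> test_functions_partial[OF \<phi>]]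
  have "l2_inner \<Omega> u (classical_grad \<phi>) = (\<Sum>i\<in>UNIV. l2_inner \<Omega> (\<lambda>x. u x $ i) (partial i \<phi>))"
    using L2_inner_integrable[OF L2_component[OF H1v_0_L2[OF u]] L\<phi>(2)]
    by (simp add: l2_inner_def inner_vec_def classical_grad_def)
  also have "\<dots> = (\<Sum>i\<in>UNIV. - l2_inner \<Omega> (\<lambda>x. weak_jac \<Omega> u x $ i $ i) \<phi>)"
    using is_weak_grad_weak_grad[OF H1_0_D(1)[OF H1v_0_D[OF u]]] \<phi>
    by (simp add: is_weak_grad_def weak_jac_def)
  also have "\<dots> = - l2_inner \<Omega> (\<lambda>x. \<Sum>i\<in>UNIV. weak_jac \<Omega> u x $ i $ i) \<phi>"
    using L2_inner_integrable[OF L L\<phi>(1)]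
    by (simp add: l2_inner_def sum_distrib_right sum_negf)
  finally show "l2_inner \<Omega> u (classical_grad \<phi>) = - l2_inner \<Omega> (\<lambda>x. \<Sum>i\<in>UNIV. weak_jac \<Omega> u x $ i $ i) \<phi>" .
qed

text \<open>\<open>weak_grad\<close> is a choice among representatives, so even for a null function
  its vanishing rests on the fundamental lemma. It serves the degenerate case of the bound by the
  dual norm.\<close>

lemma weak_grad_AE_zero:
  assumes \<Omega>: "open \<Omega>" "\<Omega> \<in> lmeasurable" and u: "u \<in> H1 \<Omega>"
    and zero: "AE x in lebesgue_on \<Omega>. u x = 0"
  shows "AE x in lebesgue_on \<Omega>. weak_grad \<Omega> u x = 0"
proof -
  note wg = is_weak_grad_weak_grad[OF u]
  have "AE x in lebesgue_on \<Omega>. weak_grad \<Omega> u x $ i = 0" for i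
  proof (rule fundamental_lemma_of_variations[OF \<Omega> L2_component[OF weak_grad_L2[OF u]]])
    fix \<phi> assume "\<phi> \<in> test_functions \<Omega>"
    then show "l2_inner \<Omega> (\<lambda>x. weak_grad \<Omega> u x $ i) \<phi> = 0"
      using wg l2_inner_AE_zero_left[OF zero] by (simp add: is_weak_grad_def)
  qed
  then have "AE x in lebesgue_on \<Omega>. \<forall>i\<in>UNIV. weak_grad \<Omega> u x $ i = 0"
    by (subst AE_ball_countable) auto
  then show ?thesis
    by eventually_elim (simp add: vec_eq_iff)
qed

lemma classical_curl_grad:
  assumes "\<phi> \<in> test_functions \<Omega>"
  shows "classical_curl (classical_grad \<phi>) = (\<lambda>x. 0)"
proof -
  have "partial i (\<lambda>y. partial j \<phi> y) x = partial j (\<lambda>y. partial i \<phi> y) x" for i j x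
    using partial_commute[OF test_functions_C_k[OF assms]] by simp
  then show ?thesis
    by (simp add: fun_eq_iff classical_curl_def classical_grad_def vec_eq_iff forall_3)
qed

text \<open>Testing with \<open>classical_grad \<phi>\<close> moves the curl onto a gradient, where
  it vanishes. The hypothesis \<open>w\<close> makes the chosen divergence a genuine one.\<close>

lemma weak_div_weak_curl:
  assumes \<Omega>: "open \<Omega>" "\<Omega> \<in> lmeasurable" and u: "u \<in> Hcurl \<Omega>"
    and w: "is_weak_div \<Omega> (weak_curl \<Omega> u) d"
  shows "AE x in lebesgue_on \<Omega>. weak_div \<Omega> (weak_curl \<Omega> u) x = 0"
proof (rule fundamental_lemma_of_variations[OF \<Omega> weak_div_L2[OF w]])
  fix \<phi> assume \<phi>: "\<phi> \<in> test_functions \<Omega>"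
  then have "classical_grad \<phi> \<in> test_fields \<Omega>"
    by (simp add: test_fields_def classical_grad_def test_functions_partial)
  then have "l2_inner \<Omega> (weak_curl \<Omega> u) (classical_grad \<phi>) = l2_inner \<Omega> u (classical_curl (classical_grad \<phi>))"
    using is_weak_curl_weak_curl[OF u] by (simp add: is_weak_curl_def)
  also have "\<dots> = 0"
    by (simp add: classical_curl_grad[OF \<phi>] l2_inner_def)
  finally show "l2_inner \<Omega> (weak_div \<Omega> (weak_curl \<Omega> u)) \<phi> = 0"
    using is_weak_div_weak_div[OF w] \<phi> by (simp add: is_weak_div_def)
qed

section \<open>Density of test functions, Poincare's inequality and the dual norm\<close>

lemma H1_0_approximation:
  assumes "w \<in> H1_0 \<Omega>" "\<epsilon> > 0"
  obtains \<phi> where "\<phi> \<in> test_functions \<Omega>" "l2_norm \<Omega> (\<lambda>x. w x - \<phi> x) < \<epsilon>"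
    "l2_norm \<Omega> (\<lambda>x. weak_grad \<Omega> w x - classical_grad \<phi> x) < \<epsilon>"
proof -
  obtain \<phi> where \<phi>: "\<phi> \<in> test_functions \<Omega>" and
    lt: "sqrt ((l2_norm \<Omega> (\<lambda>x. w x - \<phi> x))\<^sup>2 +
           (l2_norm \<Omega> (\<lambda>x. weak_grad \<Omega> w x - classical_grad \<phi> x))\<^sup>2) < \<epsilon>"
    using assms by (auto simp: H1_0_def)
  show ?thesis
    using \<phi> real_sqrt_sum_squares_ge1 real_sqrt_sum_squares_ge2 lt
    by (intro that[of \<phi>]) (blast intro: le_less_trans)+
qed

text \<open>Both sides are continuous in the \<open>H1\<close> norm, so the inequality passes from
  test functions to their closure.\<close>

lemma H1_0_Poincare:
  assumes \<Omega>: "\<Omega> \<in> lmeasurable" and R: "\<And>x. x \<in> \<Omega> \<Longrightarrow> norm x \<le> R" "R \<ge> 0"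
    and w: "w \<in> H1_0 \<Omega>"
  shows "l2_norm \<Omega> w \<le> 2 * R * l2_norm \<Omega> (weak_grad \<Omega> w)"
proof (rule field_le_epsilon)
  fix e :: real assume "e > 0"
  \<comment> \<open>Replacing \<open>w\<close> by \<open>\<phi>\<close> costs at most
    \<open>\<epsilon>\<close>, replacing the gradient at most \<open>2 * R * \<epsilon>\<close>;
    together this is \<open>e\<close>.\<close>
  define \<epsilon> where "\<epsilon> = e / (1 + 2 * R)"
  have \<epsilon>: "\<epsilon> > 0" "(1 + 2 * R) * \<epsilon> = e" using R(2) \<open>e > 0\<close> by (simp_all add: \<epsilon>_def)
  obtain \<phi> where \<phi>: "\<phi> \<in> test_functions \<Omega>" "l2_norm \<Omega> (\<lambda>x. w x - \<phi> x) < \<epsilon>"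
    "l2_norm \<Omega> (\<lambda>x. weak_grad \<Omega> w x - classical_grad \<phi> x) < \<epsilon>"
    by (rule H1_0_approximation[OF w \<epsilon>(1)])
  note Lw = H1_0_D(2)[OF w] and Lg = weak_grad_L2[OF H1_0_D(1)[OF w]]
  note L\<phi> = test_functions_L2[OF \<Omega> \<phi>(1)] and Lc = classical_grad_L2[OF \<Omega> \<phi>(1)]
  have "l2_norm \<Omega> w \<le> \<epsilon> + l2_norm \<Omega> \<phi>"
    using l2_norm_triangle[OF L2_diff[OF Lw L\<phi>] L\<phi>] \<phi>(2) by simp
  also have "l2_norm \<Omega> \<phi> \<le> 2 * R * l2_norm \<Omega> (classical_grad \<phi>)"
    by (rule test_functions_Poincare[OF \<Omega> R \<phi>(1)])
  also have "l2_norm \<Omega> (classical_grad \<phi>) \<le> \<epsilon> + l2_norm \<Omega> (weak_grad \<Omega> w)"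
    using l2_norm_triangle[OF L2_diff[OF Lc Lg] Lg] \<phi>(3)
    by (simp add: l2_norm_minus_commute[of \<Omega> "classical_grad \<phi>"])
  finally have "l2_norm \<Omega> w \<le> \<epsilon> + 2 * R * (\<epsilon> + l2_norm \<Omega> (weak_grad \<Omega> w))"
    using R(2) by (simp add: mult_left_mono)
  also have "\<dots> = 2 * R * l2_norm \<Omega> (weak_grad \<Omega> w) + e"
    using \<epsilon>(2) by (simp add: algebra_simps)
  finally show "l2_norm \<Omega> w \<le> 2 * R * l2_norm \<Omega> (weak_grad \<Omega> w) + e" .
qed

lemma H1v_0_Poincare:
  assumes \<Omega>: "\<Omega> \<in> lmeasurable" and R: "\<And>x. x \<in> \<Omega> \<Longrightarrow> norm x \<le> R" "R \<ge> 0"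
    and u: "u \<in> H1v_0 \<Omega>"
  shows "l2_norm \<Omega> u \<le> 2 * R * l2_norm \<Omega> (weak_jac \<Omega> u)"
proof (rule power2_le_imp_le)
  have "(l2_norm \<Omega> u)\<^sup>2 = (\<Sum>i\<in>UNIV. (l2_norm \<Omega> (\<lambda>x. u x $ i))\<^sup>2)"
    by (rule l2_norm_sq_components[OF H1v_0_L2[OF u]])
  also have "\<dots> \<le> (\<Sum>i\<in>UNIV. (2 * R * l2_norm \<Omega> (weak_grad \<Omega> (\<lambda>x. u x $ i)))\<^sup>2)"
    by (intro sum_mono power_mono H1_0_Poincare[OF \<Omega> R H1v_0_D[OF u]]) simp_all
  also have "\<dots> = (2 * R * l2_norm \<Omega> (weak_jac \<Omega> u))\<^sup>2"
    by (simp add: power_mult_distrib l2_norm_weak_jac_sq[OF u] sum_distrib_left)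
  finally show "(l2_norm \<Omega> u)\<^sup>2 \<le> (2 * R * l2_norm \<Omega> (weak_jac \<Omega> u))\<^sup>2" .
qed (use R(2) in simp)

text \<open>A real supremum is an upper bound only of a set that is bounded above. Membership in
  \<open>Hm1v\<close> bounds \<open>f\<close> by the full \<open>H1\<close> norm, and Poincare's
  inequality turns this into a bound by the norm of the Jacobian alone.\<close>

lemma Hm1v_le_norm:
  assumes \<Omega>: "open \<Omega>" "bounded \<Omega>" and f: "f \<in> Hm1v \<Omega>" and u: "u \<in> H1v_0 \<Omega>"
  shows "f u \<le> Hm1v_norm \<Omega> f * l2_norm \<Omega> (weak_jac \<Omega> u)"
proof -
  have \<Omega>': "\<Omega> \<in> lmeasurable" using \<Omega> by (simp add: lmeasurable_open)
  obtain R where R: "\<And>x. x \<in> \<Omega> \<Longrightarrow> norm x \<le> R" "R > 0"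
    using \<Omega>(2) bounded_pos by metis
  obtain C where C: "\<And>v. v \<in> H1v_0 \<Omega> \<Longrightarrow> \<bar>f v\<bar> \<le> C * H1v_norm \<Omega> v"
    using f unfolding Hm1v_def by blast
  have Poincare: "l2_norm \<Omega> v \<le> 2 * R * l2_norm \<Omega> (weak_jac \<Omega> v)" if "v \<in> H1v_0 \<Omega>" for v
    by (rule H1v_0_Poincare[OF \<Omega>' _ _ that]) (use R in auto)
  have H1v_le: "H1v_norm \<Omega> v \<le> (2 * R + 1) * l2_norm \<Omega> (weak_jac \<Omega> v)" if "v \<in> H1v_0 \<Omega>" for v
    using sqrt_sum_squares_le_sum[of "l2_norm \<Omega> v" "l2_norm \<Omega> (weak_jac \<Omega> v)"] Poincare[OF that]
    by (simp add: H1v_norm_def algebra_simps)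
  have f_le: "f v \<le> \<bar>C\<bar> * ((2 * R + 1) * l2_norm \<Omega> (weak_jac \<Omega> v))" if "v \<in> H1v_0 \<Omega>" for v
  proof -
    have "f v \<le> C * H1v_norm \<Omega> v" using C[OF that] by simp
    also have "\<dots> \<le> \<bar>C\<bar> * ((2 * R + 1) * l2_norm \<Omega> (weak_jac \<Omega> v))"
      by (intro mult_mono H1v_le that) (auto simp: H1v_norm_def)
    finally show ?thesis .
  qed
  show ?thesis
  \<comment> \<open>Null fields are excluded from the supremum. For them the Jacobian is null too,
    and \<open>f_le\<close> gives \<open>f u \<le> 0\<close>.\<close>
  proof (cases "l2_norm \<Omega> u = 0")
    case True
    then have "AE x in lebesgue_on \<Omega>. u x = 0"
      using l2_norm_eq_0_iff[OF H1v_0_L2[OF u]] by simp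
    then have "AE x in lebesgue_on \<Omega>. u x $ i = 0" for i
      by eventually_elim simp
    then have "AE x in lebesgue_on \<Omega>. weak_grad \<Omega> (\<lambda>x. u x $ i) x = 0" for i
      by (rule weak_grad_AE_zero[OF \<Omega>(1) \<Omega>' H1_0_D(1)[OF H1v_0_D[OF u]]])
    then have "l2_norm \<Omega> (weak_grad \<Omega> (\<lambda>x. u x $ i)) = 0" for i
      using l2_norm_eq_0_iff[OF weak_grad_L2[OF H1_0_D(1)[OF H1v_0_D[OF u]]]] by simp
    then have "l2_norm \<Omega> (weak_jac \<Omega> u) = 0"
      using l2_norm_weak_jac_sq[OF u] by simp
    then show ?thesis using f_le[OF u] by simp
  next
    case False
    \<comment> \<open>The supremum excludes fields by their own norm but divides by that of the
      Jacobian; Poincare's inequality makes the denominators positive.\<close>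
    have pos: "l2_norm \<Omega> (weak_jac \<Omega> v) > 0" if "v \<in> H1v_0 \<Omega>" "l2_norm \<Omega> v \<noteq> 0" for v
    proof (rule ccontr)
      assume "\<not> ?thesis"
      then have "l2_norm \<Omega> (weak_jac \<Omega> v) = 0"
        using l2_norm_nonneg[of \<Omega> "weak_jac \<Omega> v"] by linarith
      then show False
        using Poincare[OF that(1)] that(2) l2_norm_nonneg[of \<Omega> v] by simp
    qed
    have "f u / l2_norm \<Omega> (weak_jac \<Omega> u) \<le> Hm1v_norm \<Omega> f"
      unfolding Hm1v_norm_def
    proof (rule cSUP_upper)
      show "bdd_above ((\<lambda>v. f v / l2_norm \<Omega> (weak_jac \<Omega> v)) ` {v \<in> H1v_0 \<Omega>. l2_norm \<Omega> v \<noteq> 0})"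
        using f_le pos by (intro bdd_aboveI2[where M="\<bar>C\<bar> * (2 * R + 1)"]) (auto simp: divide_le_eq mult.assoc)
    qed (use u False in simp)
    then show ?thesis
      using pos[OF u False] by (simp add: divide_le_eq)
  qed
qed

section \<open>Boundedness of discrete fields and the convection term\<close>

text \<open>Polynomials are bounded on compact cells, and there are finitely many cells. The sum of
  the absolute values of the cell bounds dominates each of them.\<close>

lemma piecewise_polynomial_bounded:
  assumes mesh: "mesh \<Omega> \<T>" and v: "piecewise_polynomial \<Omega> \<T> v"
  obtains M where "AE x in lebesgue_on \<Omega>. norm (v x) \<le> M"
proof -
  have "\<exists>M. AE x in lebesgue_on \<Omega>. x \<in> T \<longrightarrow> norm (v x) \<le> M" if T: "T \<in> \<T>" for T
  proof -
    obtain p where p: "polynomial_function p" "AE x in lebesgue_on \<Omega>. x \<in> T \<longrightarrow> v x = p x"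
      using v T by (auto simp: piecewise_polynomial_def)
    have "compact (p ` T)"
      using mesh T p(1) by (intro compact_continuous_image continuous_on_polymonial_function polytope_imp_compact)
        (auto simp: mesh_def)
    then obtain M where "\<And>y. y \<in> p ` T \<Longrightarrow> norm y \<le> M"
      using compact_imp_bounded bounded_iff by metis
    then have "AE x in lebesgue_on \<Omega>. x \<in> T \<longrightarrow> norm (v x) \<le> M"
      using p(2) by (auto elim: eventually_mono)
    then show ?thesis by blast
  qed
  then have "\<forall>T\<in>\<T>. \<exists>M. AE x in lebesgue_on \<Omega>. x \<in> T \<longrightarrow> norm (v x) \<le> M"
    by blast
  from bchoice[OF this] obtain M where
    M: "\<forall>T\<in>\<T>. AE x in lebesgue_on \<Omega>. x \<in> T \<longrightarrow> norm (v x) \<le> M T" ..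
  have fin: "finite \<T>" and cover: "\<Omega> \<subseteq> \<Union>\<T>"
    using mesh closure_subset[of \<Omega>] by (auto simp: mesh_def)
  have "AE x in lebesgue_on \<Omega>. \<forall>T\<in>\<T>. x \<in> T \<longrightarrow> norm (v x) \<le> M T"
    using M by (subst AE_ball_countable) (auto intro: countable_finite[OF fin])
  moreover have "AE x in lebesgue_on \<Omega>. x \<in> \<Omega>"
    by (intro AE_I2) simp
  ultimately have "AE x in lebesgue_on \<Omega>. norm (v x) \<le> (\<Sum>T\<in>\<T>. \<bar>M T\<bar>)"
  proof eventually_elim
    case (elim x)
    then obtain T where T: "T \<in> \<T>" "x \<in> T" using cover by blast
    with elim have "norm (v x) \<le> \<bar>M T\<bar>" by force
    also have "\<dots> \<le> (\<Sum>T\<in>\<T>. \<bar>M T\<bar>)"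
      using fin T by (intro member_le_sum) auto
    finally show ?case .
  qed
  then show ?thesis using that by blast
qed

text \<open>Makes \<open>u \<bullet> g\<close> depend continuously on \<open>g\<close>, as the
  density argument for the convection term requires. The absolute value of \<open>M\<close> avoids a
  sign condition, since \<open>M\<close> may be negative on a null domain.\<close>

lemma L2_inner_bounded:
  fixes u g :: vector_field
  assumes u: "u \<in> borel_measurable (lebesgue_on \<Omega>)" "AE x in lebesgue_on \<Omega>. norm (u x) \<le> M"
    and g: "g \<in> L2 \<Omega>"
  shows "(\<lambda>x. u x \<bullet> g x) \<in> L2 \<Omega>" "l2_norm \<Omega> (\<lambda>x. u x \<bullet> g x) \<le> \<bar>M\<bar> * l2_norm \<Omega> g"
proof -
  have le: "AE x in lebesgue_on \<Omega>. norm (u x \<bullet> g x) \<le> norm (M *\<^sub>R g x)"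
    using u(2)
  proof eventually_elim
    case (elim x)
    then have "norm (u x) * norm (g x) \<le> \<bar>M\<bar> * norm (g x)"
      by (intro mult_right_mono) auto
    then show ?case
      using Cauchy_Schwarz_ineq2[of "u x" "g x"] by simp
  qed
  show "(\<lambda>x. u x \<bullet> g x) \<in> L2 \<Omega>"
    by (rule L2_bound[OF L2_scaleR[OF g] _ le]) (intro borel_measurable_inner u L2_D[OF g])
  from l2_norm_mono[OF this L2_scaleR[OF g] le]
  show "l2_norm \<Omega> (\<lambda>x. u x \<bullet> g x) \<le> \<bar>M\<bar> * l2_norm \<Omega> g"
    by (simp add: l2_norm_scaleR)
qed

text \<open>For a test function \<open>\<phi>\<close> the claim is the weak form of \<open>div u = 0\<close> tested with \<open>\<phi>\<^sup>2\<close>.\<close>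

lemma transport_skew_symmetric:
  fixes u :: vector_field
  assumes \<Omega>: "\<Omega> \<in> lmeasurable"
    and u: "u \<in> borel_measurable (lebesgue_on \<Omega>)" "AE x in lebesgue_on \<Omega>. norm (u x) \<le> M"
    and div: "is_weak_div \<Omega> u d" "AE x in lebesgue_on \<Omega>. d x = 0"
    and w: "w \<in> H1_0 \<Omega>"
  shows "l2_inner \<Omega> w (\<lambda>x. u x \<bullet> weak_grad \<Omega> w x) = 0"
proof -
  define g where "g = weak_grad \<Omega> w"
  have Lw: "w \<in> L2 \<Omega>" and Lg: "g \<in> L2 \<Omega>"
    using H1_0_D[OF w] weak_grad_L2 by (auto simp: g_def)
  note bounded = L2_inner_bounded[OF u]
  have test: "l2_inner \<Omega> \<phi> (\<lambda>x. u x \<bullet> classical_grad \<phi> x) = 0" if \<phi>: "\<phi> \<in> test_functions \<Omega>" for \<phi>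
  proof -
    have "classical_grad (\<lambda>x. \<phi> x * \<phi> x) x = (2 * \<phi> x) *\<^sub>R classical_grad \<phi> x" for x
      using test_functions_differentiable[OF \<phi>] by (simp add: classical_grad_def partial_mult vec_eq_iff)
    then have "l2_inner \<Omega> u (classical_grad (\<lambda>x. \<phi> x * \<phi> x)) =
        2 * l2_inner \<Omega> \<phi> (\<lambda>x. u x \<bullet> classical_grad \<phi> x)"
      by (simp add: l2_inner_def mult.assoc)
    moreover have "(\<lambda>x. \<phi> x * \<phi> x) \<in> test_functions \<Omega>"
      by (rule test_functions_mult_right[OF \<phi> test_functions_C_k[OF \<phi>]])
    ultimately show ?thesis
      using div(1) l2_inner_AE_zero_left[OF div(2)] by (simp add: is_weak_div_def)
  qed
  have "\<bar>l2_inner \<Omega> w (\<lambda>x. u x \<bullet> g x)\<bar> \<le> 0 + e" if "e > 0" for e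
  proof -
    \<comment> \<open>\<open>\<epsilon> * C\<close> is the total error of the estimate below. The
      minimum with \<open>1\<close> yields the bound of the norm of \<open>\<phi>\<close> by that of
      \<open>w\<close> plus \<open>1\<close>, and \<open>C + 1\<close> keeps the denominator
      positive.\<close>
    define C where "C = \<bar>M\<bar> * (l2_norm \<Omega> g + l2_norm \<Omega> w + 1)"
    have "C \<ge> 0" unfolding C_def by (intro mult_nonneg_nonneg add_nonneg_nonneg) auto
    define \<epsilon> where "\<epsilon> = min 1 (e / (C + 1))"
    have \<epsilon>: "\<epsilon> > 0" "\<epsilon> \<le> 1" using \<open>C \<ge> 0\<close> \<open>e > 0\<close> by (auto simp: \<epsilon>_def)
    have "\<epsilon> * C \<le> e / (C + 1) * C"
      using \<open>C \<ge> 0\<close> by (intro mult_right_mono) (auto simp: \<epsilon>_def)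
    also have "\<dots> \<le> e" using \<open>C \<ge> 0\<close> \<open>e > 0\<close> by (simp add: field_simps)
    finally have \<epsilon>C: "\<epsilon> * C \<le> e" .
    obtain \<phi> where \<phi>: "\<phi> \<in> test_functions \<Omega>" "l2_norm \<Omega> (\<lambda>x. w x - \<phi> x) < \<epsilon>"
      "l2_norm \<Omega> (\<lambda>x. g x - classical_grad \<phi> x) < \<epsilon>"
      unfolding g_def by (rule H1_0_approximation[OF w \<epsilon>(1)])
    note L\<phi> = test_functions_L2[OF \<Omega> \<phi>(1)] and Lc = classical_grad_L2[OF \<Omega> \<phi>(1)]
    note Ld = L2_diff[OF Lw L\<phi>] and Ldg = L2_diff[OF Lg Lc]
    \<comment> \<open>The pure test-function term
      \<open>(\<phi>, u \<bullet> classical_grad \<phi>)\<close> vanishes by \<open>test\<close>, so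
      it may be subtracted; each remaining term contains a small difference.\<close>
    have "l2_inner \<Omega> w (\<lambda>x. u x \<bullet> g x) =
        l2_inner \<Omega> (\<lambda>x. w x - \<phi> x) (\<lambda>x. u x \<bullet> g x) + l2_inner \<Omega> \<phi> (\<lambda>x. u x \<bullet> (g x - classical_grad \<phi> x))"
      using l2_inner_diff_left[OF Lw L\<phi> bounded(1)[OF Lg]] test[OF \<phi>(1)]
        l2_inner_diff_left[OF bounded(1)[OF Lg] bounded(1)[OF Lc] L\<phi>]
      by (simp add: l2_inner_commute[of \<Omega> \<phi>] inner_diff_right)
    then have "\<bar>l2_inner \<Omega> w (\<lambda>x. u x \<bullet> g x)\<bar> \<le>
        l2_norm \<Omega> (\<lambda>x. w x - \<phi> x) * l2_norm \<Omega> (\<lambda>x. u x \<bullet> g x) +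
        l2_norm \<Omega> \<phi> * l2_norm \<Omega> (\<lambda>x. u x \<bullet> (g x - classical_grad \<phi> x))"
      using l2_Cauchy_Schwarz[OF Ld bounded(1)[OF Lg]] l2_Cauchy_Schwarz[OF L\<phi> bounded(1)[OF Ldg]]
      by linarith
    also have "\<dots> \<le> \<epsilon> * (\<bar>M\<bar> * l2_norm \<Omega> g) + (l2_norm \<Omega> w + 1) * (\<bar>M\<bar> * \<epsilon>)"
    proof (intro add_mono mult_mono)
      show "l2_norm \<Omega> \<phi> \<le> l2_norm \<Omega> w + 1"
        using l2_norm_triangle[OF L2_diff[OF L\<phi> Lw] Lw] \<phi>(2) \<epsilon>(2)
        by (simp add: l2_norm_minus_commute[of \<Omega> \<phi>])
      show "l2_norm \<Omega> (\<lambda>x. u x \<bullet> (g x - classical_grad \<phi> x)) \<le> \<bar>M\<bar> * \<epsilon>"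
        using bounded(2)[OF Ldg] \<phi>(3) by (meson abs_ge_zero less_imp_le mult_left_mono order_trans)
    qed (use \<phi> \<epsilon> bounded(2)[OF Lg] in auto)
    also have "\<dots> = \<epsilon> * C" by (simp add: C_def algebra_simps)
    finally show ?thesis using \<epsilon>C by simp
  qed
  then have "\<bar>l2_inner \<Omega> w (\<lambda>x. u x \<bullet> g x)\<bar> \<le> 0"
    by (rule field_le_epsilon)
  then show ?thesis by (simp add: g_def)
qed

text \<open>Pointwise, the convection term tested with \<open>u\<close> is the sum over
  \<open>i\<close> of \<open>u_i\<close> times \<open>u \<bullet> \<nabla> u_i\<close>, so the
  scalar transport identity applies to each component.\<close>

lemma convect_skew_symmetric:
  assumes \<Omega>: "\<Omega> \<in> lmeasurable"
    and u: "u \<in> H1v_0 \<Omega>" "AE x in lebesgue_on \<Omega>. norm (u x) \<le> M"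
    and div: "AE x in lebesgue_on \<Omega>. weak_div \<Omega> u x = 0"
  shows "l2_inner \<Omega> (convect \<Omega> u u) u = 0"
proof -
  note Lu = H1v_0_L2[OF u(1)]
  note meas = L2_D(1)[OF Lu]
  have "convect \<Omega> u u x \<bullet> u x = (\<Sum>i\<in>UNIV. u x $ i * (u x \<bullet> weak_grad \<Omega> (\<lambda>y. u y $ i) x))" for x
    by (simp add: convect_def inner_vec_def matrix_vector_mult_def weak_jac_def mult.commute)
  then have "l2_inner \<Omega> (convect \<Omega> u u) u =
      (\<Sum>i\<in>UNIV. l2_inner \<Omega> (\<lambda>x. u x $ i) (\<lambda>x. u x \<bullet> weak_grad \<Omega> (\<lambda>y. u y $ i) x))"
    using L2_inner_integrable[OF L2_component[OF Lu]
        L2_inner_bounded(1)[OF meas u(2) weak_grad_L2[OF H1_0_D(1)[OF H1v_0_D[OF u(1)]]]]]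
    by (simp add: l2_inner_def)
  also have "\<dots> = 0"
    using transport_skew_symmetric[OF \<Omega> meas u(2) is_weak_div_weak_div[OF is_weak_div_trace_weak_jac[OF \<Omega> u(1)]] div]
      H1v_0_D[OF u(1)] by simp
  finally show ?thesis .
qed

text \<open>Lagrange's identity bounds the cross product by the product of the norms. This makes
  \<open>u \<times> B\<close> square integrable, so that Ohm's law can be split into its
  terms.\<close>

lemma L2_cross_bounded:
  assumes u: "u \<in> borel_measurable (lebesgue_on \<Omega>)" "AE x in lebesgue_on \<Omega>. norm (u x) \<le> M"
    and b: "b \<in> L2 \<Omega>"
  shows "(\<lambda>x. cross3 (u x) (b x)) \<in> L2 \<Omega>"
proof (rule L2_bound[OF L2_scaleR[OF b, of M]])
  show "(\<lambda>x. cross3 (u x) (b x)) \<in> borel_measurable (lebesgue_on \<Omega>)"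
    by (rule borel_measurable_continuous_Pair[OF u(1) L2_D(1)[OF b]])
       (intro continuous_on_cross continuous_intros)
  show "AE x in lebesgue_on \<Omega>. norm (cross3 (u x) (b x)) \<le> norm (M *\<^sub>R b x)"
    using u(2)
  proof eventually_elim
    case (elim x)
    have "(norm (cross3 (u x) (b x)))\<^sup>2 \<le> (norm (u x) * norm (b x))\<^sup>2"
      using norm_cross_dot[of "u x" "b x"] zero_le_power2[of "u x \<bullet> b x"] by linarith
    then have "norm (cross3 (u x) (b x)) \<le> norm (u x) * norm (b x)"
      by (rule power2_le_imp_le) simp
    also have "\<dots> \<le> \<bar>M\<bar> * norm (b x)"
      using elim by (intro mult_right_mono) auto
    finally show ?case by simp
  qed
qed

section \<open>Energy estimates\<close>

theorem theorem1:
  fixes \<Omega> :: "(real ^ 3) set"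
    and \<T> :: "(real ^ 3) set set"
    and Rey Rem S RH :: real
    and f :: "vector_field \<Rightarrow> real"
    and Gh :: "scalar_field set"
    and Ch Dh :: "vector_field set"
    and Lh :: "scalar_field set"
    and Vh :: "vector_field set"
    and Qh :: "scalar_field set"
    and Xh :: "(vector_field \<times> scalar_field \<times> vector_field \<times> vector_field \<times> vector_field) set"
    and u E B j :: vector_field
    and p :: scalar_field
  assumes domain: "bounded \<Omega>" "contractible \<Omega>" "lipschitz_polyhedron \<Omega>"
    and constants: "Rey > 0" "Rem > 0" "S > 0" "RH \<ge> 0"
    and force: "f \<in> Hm1v \<Omega>"
    and mesh: "mesh \<Omega> \<T>"
    and de_rham: "fe_de_rham \<Omega> \<T> Gh Ch Dh Lh"
    and velocity: "fe_space \<Omega> \<T> Vh" "Vh \<subseteq> H1v_0 \<Omega>"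
    and pressure: "fe_space \<Omega> \<T> Qh" "Qh \<subseteq> L2_0 \<Omega>"
    and stable: "inf_sup_stable \<Omega> Vh Qh"
    and incompressible: "enforces_incompressibility \<Omega> Vh Qh"
    and Xh: "Xh = Vh \<times> Qh \<times> Ch \<times> Dh \<times> Ch"
    and solution: "(u, p, E, B, j) \<in> Xh"
    and equations: "\<forall>(v, q, F, C, k) \<in> Xh.
        inverse Rey * l2_inner \<Omega> (weak_jac \<Omega> u) (weak_jac \<Omega> v)
          + l2_inner \<Omega> (convect \<Omega> u u) v
          - S * l2_inner \<Omega> (\<lambda>x. cross3 (j x) (B x)) v
          - l2_inner \<Omega> p (weak_div \<Omega> v) = f v
      \<and> l2_inner \<Omega> j F - l2_inner \<Omega> B (weak_curl \<Omega> F) = 0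
      \<and> l2_inner \<Omega> (weak_curl \<Omega> E) C + l2_inner \<Omega> (weak_div \<Omega> B) (weak_div \<Omega> C) = 0
      \<and> inverse Rem * l2_inner \<Omega> j k
          - l2_inner \<Omega> (\<lambda>x. E x + cross3 (u x) (B x) - RH *\<^sub>R cross3 (j x) (B x)) k = 0
      \<and> - l2_inner \<Omega> (weak_div \<Omega> u) q = 0"
  shows "(AE x in lebesgue_on \<Omega>. weak_div \<Omega> B x = 0)
    \<and> (AE x in lebesgue_on \<Omega>. weak_curl \<Omega> E x = 0)
    \<and> inverse Rey * (l2_norm \<Omega> (weak_jac \<Omega> u))\<^sup>2 + inverse Rem * S * (l2_norm \<Omega> j)\<^sup>2 = f u
    \<and> 1 / 2 * inverse Rey * (l2_norm \<Omega> (weak_jac \<Omega> u))\<^sup>2 + inverse Rem * S * (l2_norm \<Omega> j)\<^sup>2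
        \<le> Rey / 2 * (Hm1v_norm \<Omega> f)\<^sup>2"
proof -

  \<comment> \<open>Spaces and tested equations\<close>
  have \<Omega>: "open \<Omega>" using domain(3) by (simp add: lipschitz_polyhedron_def lipschitz_domain_def)
  then have \<Omega>': "\<Omega> \<in> lmeasurable" using domain(1) by (simp add: lmeasurable_open)
  have mem: "u \<in> Vh" "p \<in> Qh" "E \<in> Ch" "B \<in> Dh" "j \<in> Ch"
    using solution by (simp_all add: Xh)
  have "Ch \<subseteq> Hcurl_0 \<Omega>" "Dh \<subseteq> Hdiv_0 \<Omega>" and curl_Ch: "weak_curl \<Omega> ` Ch \<subseteq> Dh"
    using de_rham by (simp_all add: fe_de_rham_def)
  then have "Ch \<subseteq> Hcurl \<Omega>" "Dh \<subseteq> Hdiv \<Omega>"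
    by (auto simp: Hcurl_0_def Hdiv_0_def)
  moreover have "Hcurl \<Omega> \<subseteq> L2 \<Omega>" "Hdiv \<Omega> \<subseteq> L2 \<Omega>"
    by (auto simp: Hcurl_def Hdiv_def)
  ultimately have spaces: "Ch \<subseteq> L2 \<Omega>" "Dh \<subseteq> L2 \<Omega>" "Ch \<subseteq> Hcurl \<Omega>" "Dh \<subseteq> Hdiv \<Omega>"
    by blast+
  \<comment> \<open>The test tuple is the solution itself, which puts \<open>E\<close> into Ampere's
    law and \<open>j\<close> into Ohm's law.\<close>
  have momentum: "inverse Rey * l2_inner \<Omega> (weak_jac \<Omega> u) (weak_jac \<Omega> u) + l2_inner \<Omega> (convect \<Omega> u u) u
        - S * l2_inner \<Omega> (\<lambda>x. cross3 (j x) (B x)) u - l2_inner \<Omega> p (weak_div \<Omega> u) = f u"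
    and ampere: "l2_inner \<Omega> j E - l2_inner \<Omega> B (weak_curl \<Omega> E) = 0"
    and ohm: "inverse Rem * l2_inner \<Omega> j j
          - l2_inner \<Omega> (\<lambda>x. E x + cross3 (u x) (B x) - RH *\<^sub>R cross3 (j x) (B x)) j = 0"
    using equations[unfolded Xh, rule_format, of "(u, p, E, B, j)"] mem by simp_all
  \<comment> \<open>Only the fourth slot of the test tuple enters this equation; the other slots are
    filled with the solution.\<close>
  have induction: "l2_inner \<Omega> (weak_curl \<Omega> E) C + l2_inner \<Omega> (weak_div \<Omega> B) (weak_div \<Omega> C) = 0"
    if "C \<in> Dh" for C
    using equations[unfolded Xh, rule_format, of "(u, p, E, C, j)"] mem that by simp
  have mass: "l2_inner \<Omega> (weak_div \<Omega> u) q = 0" if "q \<in> Qh" for q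
    using equations[unfolded Xh, rule_format, of "(u, q, E, B, j)"] mem that by simp

  \<comment> \<open>Faraday's law and Gauss's law\<close>
  have E: "E \<in> Hcurl \<Omega>" using mem spaces by blast
  \<comment> \<open>Membership in \<open>Dh\<close> plays a double role: it makes
    \<open>curl E\<close> an admissible test field and guarantees that it has a weak
    divergence.\<close>
  have curlE_Dh: "weak_curl \<Omega> E \<in> Dh" using mem curl_Ch by blast
  then obtain d where "is_weak_div \<Omega> (weak_curl \<Omega> E) d"
    using spaces by (auto simp: Hdiv_def)
  then have "AE x in lebesgue_on \<Omega>. weak_div \<Omega> (weak_curl \<Omega> E) x = 0"
    by (rule weak_div_weak_curl[OF \<Omega> \<Omega>' E])
  from l2_inner_AE_zero_left[OF this, of "weak_div \<Omega> B"]
  have "l2_inner \<Omega> (weak_curl \<Omega> E) (weak_curl \<Omega> E) = 0"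
    using induction[OF curlE_Dh] by (simp add: l2_inner_commute[of \<Omega> "weak_div \<Omega> B"])
  then have faraday: "AE x in lebesgue_on \<Omega>. weak_curl \<Omega> E x = 0"
    using l2_inner_self_eq_0_iff[OF weak_curl_L2[OF E]] by simp
  obtain d where d: "is_weak_div \<Omega> B d"
    using mem spaces by (auto simp: Hdiv_def)
  have "l2_inner \<Omega> (weak_div \<Omega> B) (weak_div \<Omega> B) = 0"
    using induction[OF mem(4)] l2_inner_AE_zero_left[OF faraday] by simp
  then have gauss: "AE x in lebesgue_on \<Omega>. weak_div \<Omega> B x = 0"
    using l2_inner_self_eq_0_iff[OF weak_div_L2[OF d]] by simp

  \<comment> \<open>Energy identity\<close>
  have u: "u \<in> H1v_0 \<Omega>" using mem velocity by blast
  note Lu = H1v_0_L2[OF u]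
  have LE: "E \<in> L2 \<Omega>" and LB: "B \<in> L2 \<Omega>" and Lj: "j \<in> L2 \<Omega>"
    using mem spaces by blast+
  have "piecewise_polynomial \<Omega> \<T> u"
    using mem velocity by (simp add: fe_space_def)
  \<comment> \<open>The bound on the velocity is used twice, for the convection term and for the
    square integrability of \<open>u \<times> B\<close>.\<close>
  then obtain M where M: "AE x in lebesgue_on \<Omega>. norm (u x) \<le> M"
    using piecewise_polynomial_bounded[OF mesh] by blast
  have "AE x in lebesgue_on \<Omega>. weak_div \<Omega> u x = 0"
    using incompressible mem mass by (simp add: enforces_incompressibility_def)
  then have conv: "l2_inner \<Omega> (convect \<Omega> u u) u = 0"
    by (rule convect_skew_symmetric[OF \<Omega>' u M])
  have press: "l2_inner \<Omega> p (weak_div \<Omega> u) = 0"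
    using mass[OF mem(2)] by (simp add: l2_inner_commute)
  \<comment> \<open>Ampere's law tested with \<open>E\<close> gives
    \<open>(j, E) = (B, curl E)\<close>, which vanishes by Faraday's law.\<close>
  have "l2_inner \<Omega> E j = 0"
    using ampere l2_inner_AE_zero_left[OF faraday] by (simp add: l2_inner_commute)
  \<comment> \<open>The Hall term is removed pointwise under the integral, so that square
    integrability of \<open>j \<times> B\<close> does not enter.\<close>
  moreover have "l2_inner \<Omega> (\<lambda>x. E x + cross3 (u x) (B x) - RH *\<^sub>R cross3 (j x) (B x)) j =
      l2_inner \<Omega> (\<lambda>x. E x + cross3 (u x) (B x)) j"
    by (simp add: l2_inner_def inner_diff_left dot_cross_self)
  moreover have "\<dots> = l2_inner \<Omega> E j + l2_inner \<Omega> (\<lambda>x. cross3 (u x) (B x)) j"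
    by (intro l2_inner_add_left LE Lj L2_cross_bounded[OF L2_D(1)[OF Lu] M LB])
  \<comment> \<open>Swapping the outer entries of the scalar triple product changes its sign; this
    couples Ohm's law to the Lorentz force in the momentum equation.\<close>
  moreover have "cross3 (u x) (B x) \<bullet> j x = - (cross3 (j x) (B x) \<bullet> u x)" for x
    by (simp add: cross3_simps)
  then have "l2_inner \<Omega> (\<lambda>x. cross3 (u x) (B x)) j = - l2_inner \<Omega> (\<lambda>x. cross3 (j x) (B x)) u"
    by (simp add: l2_inner_def)
  ultimately have "inverse Rem * (l2_norm \<Omega> j)\<^sup>2 = - l2_inner \<Omega> (\<lambda>x. cross3 (j x) (B x)) u"
    using ohm by (simp add: l2_norm_sq)
  then have "S * (inverse Rem * (l2_norm \<Omega> j)\<^sup>2) = - S * l2_inner \<Omega> (\<lambda>x. cross3 (j x) (B x)) u"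
    by simp
  then have energy: "inverse Rey * (l2_norm \<Omega> (weak_jac \<Omega> u))\<^sup>2 + inverse Rem * S * (l2_norm \<Omega> j)\<^sup>2 = f u"
    using momentum conv press by (simp add: l2_norm_sq ac_simps)

  \<comment> \<open>Energy estimate\<close>
  define a N where "a = l2_norm \<Omega> (weak_jac \<Omega> u)" and "N = Hm1v_norm \<Omega> f"
  have "f u \<le> N * a"
    unfolding a_def N_def by (rule Hm1v_le_norm[OF \<Omega> domain(1) force u])
  \<comment> \<open>Young's inequality, weighted so that half of the viscous term can be absorbed:
    expand \<open>(Rey * N - a)^2 \<ge> 0\<close> and divide by \<open>2 * Rey\<close>.\<close>
  also have "N * a \<le> Rey / 2 * N\<^sup>2 + 1 / 2 * inverse Rey * a\<^sup>2"
    using zero_le_power2[of "Rey * N - a"] constants(1)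
    by (simp add: field_simps power2_eq_square)
  finally have "1 / 2 * inverse Rey * a\<^sup>2 + inverse Rem * S * (l2_norm \<Omega> j)\<^sup>2 \<le> Rey / 2 * N\<^sup>2"
    using energy by (simp add: a_def)
  with gauss faraday energy show ?thesis
    by (simp add: a_def N_def)
qed

end
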